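(* Let $1\le k\le r$ and let $a\colon\mathcal F\to(0,\infty)$, $b\colon\mathcal F\to[0,\infty)$ satisfy the condition $\mathrm{NC}_k$, where $\mathcal F$ is the set of front faces of $[0,1]^r$. Assume that at every $F\in\mathcal F$ the map $b$ is increasing at $F$ or eventually constant at $F$. Then, given any sequence in $(0,1]$ converging to $0$, there are a subsequence $(s_n)_{n\ge1}$ of it and a sequence $(z_n)_{n\ge1}$ of vertex copulas of order $k$ such that for $c^\infty=\operatorname{tnest}((z_n)_{n\ge1})$ one has $$\lim_{n\to\infty}\frac{c^\infty_F\bigl(s_n[0,1]^{\dim F}\bigr)}{(s_n)^{b(F)}}=a(F)\qquad\text{for all }F\in\mathcal F,$$ and $\operatorname{tdeg}_{c^\infty}=b$.
   Context: Faces. Let $V=\{0,1\}^r$. For $\nu\in V$, $F(\nu)=\{u\in[0,1]^r: u_i=0\text{ if }\nu_i=0\}$ is a front face, of dimension $\sum_i\nu_i$; $\mathcal F=\{F(\nu):\nu\in V\}$; each $F\in\mathcal F$ is identified with $[0,1]^{\dim F}$. Put $\hat\nu=(1,\dots,1)-\nu$; the complementary front face of $F(\nu)$ is $F(\nu)^c=F(\hat\nu)$. $\pi^F\colon[0,1]^r\to F^c$ is the coordinate projection along $F$; the same symbol denotes push-forward of measures. For a measure $c$ on $[0,1]^r$, $c_F=\pi^{F^c}(c)$ is its push-forward to $F$, and $\operatorname{tdeg}_c(F)=\inf\{\tau\in\mathbb R:\liminf_{s\to0}c_F(s[0,1]^{\dim F})/s^\tau=\infty\}$. Conditions on maps. A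 map $b$ on $\mathcal F$ is increasing at $F$ (resp. eventually constant at $F$) if $b(F)<b(F')$ (resp. $b(F)=b(F')$) for each $F'\in\mathcal F$ with $F\subset F'$, $F\ne F'$. The pair $a,b$ satisfies $\mathrm{NC}_k$ if: (i) $b(F')\ge b(F)$ whenever $F'\supset F$; (ii) $(a(F),b(F))=(1,\dim F)$ for each $F\in\mathcal F$ with $\dim F\le k$; (iii) if $b$ is eventually constant at $F$, then $\sum_{F'\supset F}(-1)^{\dim F'-\dim F}a(F')\ge0$. Vertex copulas. A copula of order $k$ is a Borel probability measure on $[0,1]^r$ whose push-forward to each front face of dimension $k$ is uniform. For $u\in(0,1)^r$ decompose $[0,1]^r$ into the $2^r$ boxes $J_\nu=\prod_iK_i$, $\nu\in V$, with $K_i=[0,u_i]$ if $\nu_i=0$ and $K_i=[u_i,1]$ if $\nu_i=1$. Via $u$, $z\in\mathbb R^V$ is identified with the signed measure that is uniform on each $J_\nu$ with mass $z(\nu)$ there. $C_k(u)$ is the set of $z\in[0,1]^V$ whose associated measure is a copula of order $k$. A sequence of vertex copulas of order $k$ is a sequence $z_n\in C_k(u^{(n)})$ for some $u^{(n)}\in(0,1)^r$. Tail nesting. A grid decomposition $\mathcal J$ of $[0,1]^r$ is a product of finite decompositions of $[0,1]$ into compact intervals of positive length with disjoint interiors; a grid copula is a copula uniform on each box of some grid. For $J=\prod_iJ_i\in\mathcal J$ let $\nu_J\in V$ be given by $(\nu_J)_i=0$ if $0\in J_i$ and $(\nu_J)_i=1$ otherwise, and let $\imath_J\colon[0,1]^r\to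 J$ be the coordinatewise increasing affine bijection. For $z\in C_k(u)$ and $\nu\in V$ let $z^{(\nu)}=\pi^{F(\nu)}(z)\times\mathrm{cu}_{F(\nu)}$ be the product of the push-forward of $z$ to $F(\hat\nu)$ with the uniform probability measure on $F(\nu)$. For a grid copula $c$ of order $k$ with grid $\mathcal J$, $\operatorname{tnest}(z,c)$ is obtained from $c$ by replacing, for each $J\in\mathcal J$, $c|_J$ by $c(J)\cdot(\imath_J)_*z^{(\nu_J)}$; its grid is obtained by subdividing each $J$ into the boxes $\imath_J(J_\nu)$. For $z_n\in C_k(u^{(n)})$ put $c^1=z_1$, $c^n=\operatorname{tnest}(z_n,c^{n-1})$; $\operatorname{tnest}((z_n)_{n\ge1})=c^\infty$ is the limit (weak limit, which exists) of $(c^n)$. *)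

theory Defs
  imports "HOL-Probability.Probability"
begin

text \<open>
  The dimension \<open>r\<close> is \<open>CARD('n)\<close>; a vertex in \<open>{0,1}\<^sup>r\<close> is a vector of truth values
  (\<open>True\<close> stands for 1), and the unit cube is \<open>cbox 0 1\<close>.
  Measures on the unit cube or on one of its faces are Borel measures on the whole of
  \<open>real^'n\<close> that are concentrated there.
\<close>

type_synonym 'n vertex = "bool ^ 'n"


section \<open>Front faces\<close>

definition front_face :: "('n::finite) vertex \<Rightarrow> (real^'n) set" where
  "front_face \<nu> = {x \<in> cbox 0 1. \<forall>i. \<not> \<nu> $ i \<longrightarrow> x $ i = 0}"

definition front_faces :: "(real^'n::finite) set set" where
  "front_faces = range front_face"

text \<open>The inverse of \<^const>\<open>front_face\<close>, see \<open>face_vertex_front_face\<close> below.\<close>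

definition face_vertex :: "(real^'n::finite) set \<Rightarrow> 'n vertex" where
  "face_vertex F = (\<chi> i. \<exists>x\<in>F. x $ i \<noteq> 0)"

definition compl_vertex :: "('n::finite) vertex \<Rightarrow> 'n vertex" where
  "compl_vertex \<nu> = (\<chi> i. \<not> \<nu> $ i)"

definition compl_face :: "(real^'n::finite) set \<Rightarrow> (real^'n) set" where
  "compl_face F = front_face (compl_vertex (face_vertex F))"

text \<open>The coordinate projection onto \<open>compl_face F\<close>, collapsing the directions of \<open>F\<close>.\<close>

definition proj_along :: "(real^'n::finite) set \<Rightarrow> real^'n \<Rightarrow> real^'n" where
  "proj_along F x = (\<chi> i. if face_vertex F $ i then 0 else x $ i)"

lemma face_vertex_front_face: "face_vertex (front_face \<nu>) = \<nu>"
proof -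
  have "(\<exists>x\<in>front_face \<nu>. x $ i \<noteq> 0) = \<nu> $ i" for i
  proof
    assume "\<nu> $ i"
    then have "(\<chi> j. if \<nu> $ j then 1 else 0) \<in> front_face \<nu>"
      by (auto simp: front_face_def mem_box_cart)
    with \<open>\<nu> $ i\<close> show "\<exists>x\<in>front_face \<nu>. x $ i \<noteq> 0"
      by (intro bexI) auto
  qed (auto simp: front_face_def)
  then show ?thesis
    by (simp add: face_vertex_def vec_eq_iff)
qed

text \<open>The linear dimension of a front face is the number of ones of its vertex.\<close>

lemma dim_front_face: "dim (front_face \<nu>) = card {i. \<nu> $ i}"
proof -
  let ?B = "(\<lambda>i. axis i (1::real)) ` {i. \<nu> $ i}"
  have 1: "front_face \<nu> \<subseteq> span ?B"
  proof
    fix x assume x: "x \<in> front_face \<nu>"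
    have "(\<Sum>i\<in>UNIV. x $ i *\<^sub>R axis i 1) \<in> span ?B"
    proof (rule span_sum)
      fix i
      show "x $ i *\<^sub>R axis i 1 \<in> span ?B"
      proof (cases "\<nu> $ i")
        case True
        then show ?thesis by (intro span_mul span_base) auto
      next
        case False
        then show ?thesis using x by (simp add: front_face_def span_zero)
      qed
    qed
    then show "x \<in> span ?B"
      using basis_expansion[of x] by (simp add: scalar_mult_eq_scaleR)
  qed
  have 2: "?B \<subseteq> front_face \<nu>"
    by (auto simp: front_face_def mem_box_cart axis_def)
  have 3: "independent ?B"
    by (rule independent_mono[OF independent_Basis]) (auto simp: axis_in_Basis_iff)
  have "dim (front_face \<nu>) = card ?B"
    by (rule dim_unique[OF 2 1 3 refl])
  also have "\<dots> = card {i. \<nu> $ i}"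
    by (rule card_image) (auto simp: inj_on_def axis_eq_axis)
  finally show ?thesis .
qed


section \<open>Tail degrees and the condition on maps\<close>

text \<open>The push-forward \<open>c\<^sub>F\<close> of \<open>c\<close> to \<open>F\<close>.\<close>

definition face_marginal :: "(real^'n::finite) measure \<Rightarrow> (real^'n) set \<Rightarrow> (real^'n) measure" where
  "face_marginal c F = distr c borel (proj_along (compl_face F))"

text \<open>Under the identification of \<open>F\<close> with \<open>[0,1]\<^bsup>dim F\<^esup>\<close>, the cube \<open>s[0,1]\<^bsup>dim F\<^esup>\<close> is \<open>s F\<close>.\<close>

definition tail_mass :: "(real^'n::finite) measure \<Rightarrow> (real^'n) set \<Rightarrow> real \<Rightarrow> real" where
  "tail_mass c F s = measure (face_marginal c F) ((\<lambda>x. s *\<^sub>R x) ` F)"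

definition tdeg :: "(real^'n::finite) measure \<Rightarrow> (real^'n) set \<Rightarrow> ereal" where
  "tdeg c F = Inf {ereal \<tau> | \<tau> :: real.
     Liminf (at_right 0) (\<lambda>s. ereal (tail_mass c F s / s powr \<tau>)) = \<infinity>}"

definition increasing_at :: "((real^'n::finite) set \<Rightarrow> real) \<Rightarrow> (real^'n) set \<Rightarrow> bool" where
  "increasing_at b F \<longleftrightarrow> (\<forall>F'\<in>front_faces. F \<subset> F' \<longrightarrow> b F < b F')"

definition eventually_constant_at :: "((real^'n::finite) set \<Rightarrow> real) \<Rightarrow> (real^'n) set \<Rightarrow> bool" where
  "eventually_constant_at b F \<longleftrightarrow> (\<forall>F'\<in>front_faces. F \<subset> F' \<longrightarrow> b F = b F')"

definition NC ::
  "nat \<Rightarrow> ((real^'n::finite) set \<Rightarrow> real) \<Rightarrow> ((real^'n) set \<Rightarrow> real) \<Rightarrow> bool" where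
  "NC k a b \<longleftrightarrow>
     (\<forall>F\<in>front_faces. \<forall>F'\<in>front_faces. F \<subseteq> F' \<longrightarrow> b F \<le> b F') \<and>
     (\<forall>F\<in>front_faces. dim F \<le> k \<longrightarrow> a F = 1 \<and> b F = real (dim F)) \<and>
     (\<forall>F\<in>front_faces. eventually_constant_at b F \<longrightarrow>
        0 \<le> (\<Sum>F' | F' \<in> front_faces \<and> F \<subseteq> F'. (-1) ^ (dim F' - dim F) * a F'))"


section \<open>Copulas\<close>

text \<open>The uniform probability measure on the front face \<open>F\<close>, as the image of the uniform
  probability measure on the cube under the projection onto \<open>F\<close>.\<close>

definition uniform_face :: "(real^'n::finite) set \<Rightarrow> (real^'n) measure" where
  "uniform_face F = face_marginal (uniform_measure lborel (cbox 0 1)) F"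

definition copula :: "nat \<Rightarrow> (real^'n::finite) measure \<Rightarrow> bool" where
  "copula k c \<longleftrightarrow> sets c = sets borel \<and> prob_space c \<and> emeasure c (cbox 0 1) = 1 \<and>
     (\<forall>F\<in>front_faces. dim F = k \<longrightarrow> face_marginal c F = uniform_face F)"

text \<open>The weighted sum of the Borel measures \<open>M i\<close> over the finite index set \<open>I\<close>.\<close>

definition mixture :: "'i set \<Rightarrow> ('i \<Rightarrow> ennreal) \<Rightarrow> ('i \<Rightarrow> 'a::topological_space measure) \<Rightarrow> 'a measure" where
  "mixture I w M = measure_of UNIV (sets borel) (\<lambda>A. \<Sum>i\<in>I. w i * emeasure (M i) A)"

lemma sets_mixture: "sets (mixture I w M) = sets borel"
  unfolding mixture_def by (metis sets.sets_measure_of_eq space_borel)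

lemma emeasure_mixture:
  assumes M: "\<And>i. i \<in> I \<Longrightarrow> sets (M i) = sets borel" and A: "A \<in> sets borel"
  shows "emeasure (mixture I w M) A = (\<Sum>i\<in>I. w i * emeasure (M i) A)"
proof (rule emeasure_measure_of[OF mixture_def])
  show "countably_additive (sets (mixture I w M)) (\<lambda>A. \<Sum>i\<in>I. w i * emeasure (M i) A)"
    unfolding sets_mixture
  proof (rule countably_additiveI)
    fix B :: "nat \<Rightarrow> 'b set"
    assume B: "range B \<subseteq> sets borel" "disjoint_family B"
    have "(\<Sum>n. \<Sum>i\<in>I. w i * emeasure (M i) (B n)) = (\<Sum>i\<in>I. \<Sum>n. w i * emeasure (M i) (B n))"
      by (rule suminf_sum) auto
    also have "\<dots> = (\<Sum>i\<in>I. w i * emeasure (M i) (\<Union>n. B n))"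
      using B M by (intro sum.cong refl) (simp add: suminf_emeasure)
    finally show "(\<Sum>n. \<Sum>i\<in>I. w i * emeasure (M i) (B n)) =
      (\<Sum>i\<in>I. w i * emeasure (M i) (\<Union>n. B n))" .
  qed
qed (use A sets_mixture in \<open>auto simp: positive_def\<close>)

text \<open>The box \<open>J\<^sub>\<nu>\<close> of the decomposition of the cube at \<open>u\<close>.\<close>

definition vertex_box :: "real^'n::finite \<Rightarrow> 'n vertex \<Rightarrow> (real^'n) set" where
  "vertex_box u \<nu> = cbox (\<chi> i. if \<nu> $ i then u $ i else 0) (\<chi> i. if \<nu> $ i then 1 else u $ i)"

text \<open>The measure identified with \<open>z\<close> via \<open>u\<close>; only meant for nonnegative \<open>z\<close>, since
  \<^const>\<open>ennreal\<close> truncates.\<close>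

definition vertex_measure :: "real^'n::finite \<Rightarrow> ('n vertex \<Rightarrow> real) \<Rightarrow> (real^'n) measure" where
  "vertex_measure u z =
     mixture UNIV (\<lambda>\<nu>. ennreal (z \<nu>)) (\<lambda>\<nu>. uniform_measure lborel (vertex_box u \<nu>))"

definition vertex_copulas :: "nat \<Rightarrow> real^'n::finite \<Rightarrow> ('n vertex \<Rightarrow> real) set" where
  "vertex_copulas k u = {z. (\<forall>\<nu>. 0 \<le> z \<nu> \<and> z \<nu> \<le> 1) \<and> copula k (vertex_measure u z)}"


section \<open>Tail nesting\<close>

text \<open>
  A grid is given by the set of its boxes. For a box \<open>J = J\<^sub>1 \<times> \<dots> \<times> J\<^sub>r\<close>, \<open>grid_vertex J\<close> is
  \<open>\<nu>\<^sub>J\<close> (the factor \<open>J\<^sub>i\<close> is the image of \<open>J\<close> under the \<open>i\<close>-th coordinate), and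
  \<open>grid_map J\<close> is the coordinatewise increasing affine bijection from the cube onto \<open>J\<close>.
\<close>

definition grid_vertex :: "(real^'n::finite) set \<Rightarrow> 'n vertex" where
  "grid_vertex J = (\<chi> i. 0 \<notin> (\<lambda>x. x $ i) ` J)"

definition grid_map :: "(real^'n::finite) set \<Rightarrow> real^'n \<Rightarrow> real^'n" where
  "grid_map J x = (\<chi> i. interval_lowerbound J $ i +
     x $ i * (interval_upperbound J $ i - interval_lowerbound J $ i))"

text \<open>The product measure \<open>z\<^bsup>(\<nu>)\<^esup>\<close>: a point of the cube is the sum of its components in
  the two complementary front faces.\<close>

definition partial_copula ::
  "real^'n::finite \<Rightarrow> ('n vertex \<Rightarrow> real) \<Rightarrow> 'n vertex \<Rightarrow> (real^'n) measure" where
  "partial_copula u z \<nu> =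
     distr (distr (vertex_measure u z) borel (proj_along (front_face \<nu>)) \<Otimes>\<^sub>M uniform_face (front_face \<nu>))
       borel (\<lambda>(x, y). x + y)"

definition vertex_grid :: "real^'n::finite \<Rightarrow> (real^'n) set set" where
  "vertex_grid u = range (vertex_box u)"

definition tnest_grid :: "real^'n::finite \<Rightarrow> (real^'n) set set \<Rightarrow> (real^'n) set set" where
  "tnest_grid u G = {grid_map J ` vertex_box u \<nu> | J \<nu>. J \<in> G}"

text \<open>The boxes of a grid overlap only in null sets of a copula that is uniform on each box,
  so that replacing the restrictions to all boxes amounts to a sum over the boxes.\<close>

definition tnest :: "real^'n::finite \<Rightarrow> ('n vertex \<Rightarrow> real) \<Rightarrow>
    (real^'n) set set \<Rightarrow> (real^'n) measure \<Rightarrow> (real^'n) measure" where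
  "tnest u z G c =
     mixture G (\<lambda>J. emeasure c J) (\<lambda>J. distr (partial_copula u z (grid_vertex J)) borel (grid_map J))"

text \<open>Sequences are indexed from 0 instead of 1; the iteration keeps track of the grid.\<close>

primrec tnest_iter :: "(nat \<Rightarrow> real^'n::finite) \<Rightarrow> (nat \<Rightarrow> 'n vertex \<Rightarrow> real) \<Rightarrow> nat \<Rightarrow>
    (real^'n) set set \<times> (real^'n) measure" where
  "tnest_iter u z 0 = (vertex_grid (u 0), vertex_measure (u 0) (z 0))"
| "tnest_iter u z (Suc n) =
     (tnest_grid (u (Suc n)) (fst (tnest_iter u z n)),
      tnest (u (Suc n)) (z (Suc n)) (fst (tnest_iter u z n)) (snd (tnest_iter u z n)))"

definition weak_limit :: "(nat \<Rightarrow> 'a::topological_space measure) \<Rightarrow> 'a measure \<Rightarrow> bool" where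
  "weak_limit M N \<longleftrightarrow> sets N = sets borel \<and> prob_space N \<and>
     (\<forall>f :: 'a \<Rightarrow> real. continuous_on UNIV f \<and> bounded (range f) \<longrightarrow>
        (\<lambda>n. integral\<^sup>L (M n) f) \<longlonglongrightarrow> integral\<^sup>L N f)"

text \<open>\<open>c = tnest((z\<^sub>n))\<close>; stated as a relation, weak limits being unique.\<close>

definition is_tnest_limit :: "(nat \<Rightarrow> real^'n::finite) \<Rightarrow> (nat \<Rightarrow> 'n vertex \<Rightarrow> real) \<Rightarrow>
    (real^'n) measure \<Rightarrow> bool" where
  "is_tnest_limit u z c \<longleftrightarrow> weak_limit (\<lambda>n. snd (tnest_iter u z n)) c"

end

theory Submission
  imports Defs "HOL-Real_Asymp.Real_Asymp"
begin

text \<open>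
  Nesting at the origin makes the tails multiplicative: if all \<open>u\<^sub>n\<close> are constant vectors \<open>q\<^sub>n\<close>
  and \<open>\<sigma>\<^sub>n = q\<^sub>0 \<dots> q\<^sub>n\<close>, then the mass of \<open>\<sigma>\<^sub>n F\<close> under \<open>c\<^sub>F\<close> is the product over \<open>j \<le> n\<close> of the masses
  \<open>g\<^sub>j(F)\<close> that \<open>z\<^sub>j\<close> gives to the vertices vanishing on \<open>F\<close>.
  The choice \<open>g\<^sub>0(F) = a(F) q\<^sub>0\<^bsup>b(F)\<^esup>\<close> and \<open>g\<^sub>n(F) = q\<^sub>n\<^bsup>b(F)\<^esup>\<close> for \<open>n \<ge> 1\<close> therefore gives exactly
  \<open>a(F) \<sigma>\<^sub>n\<^bsup>b(F)\<^esup>\<close>. The weights \<open>z\<^sub>n\<close> are recovered from \<open>g\<^sub>n\<close> by Moebius inversion; they are nonnegative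
  as soon as \<open>q\<^sub>n \<le> p\<close> for a small \<open>p\<close>, and they define a copula of order \<open>k\<close> since \<open>g\<^sub>n\<close> agrees
  with its value for the uniform measure on faces of dimension at most \<open>k\<close>.
  The \<open>\<sigma>\<^sub>n\<close> hit infinitely many members of the given sequence while the ratios \<open>q\<^sub>n\<close> stay in
  \<open>[p\<^sup>2, p]\<close>; the lower bound on the ratios controls the tails between the scales and so yields
  the tail degree.

  The nested copulas are realised on one probability space, the product of the vertex copulas:
  in each step the coordinates that are still below the current scale are replaced by
  rescaled coordinates of a fresh sample. This process converges pointwise, whence weak convergence.
\<close>

section \<open>Moebius inversion on the subsets of a finite type\<close>

text \<open>Moebius inverse of summation over supersets in the Boolean lattice. Reading
  \<open>g G\<close> as the mass of the vertices that vanish at least on \<open>G\<close>, the value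
  at \<open>S\<close> is the mass of the vertex whose zeros are exactly \<open>S\<close>.\<close>

definition moebius :: "('a::finite set \<Rightarrow> real) \<Rightarrow> 'a set \<Rightarrow> real" where
  "moebius g S = (\<Sum>G | S \<subseteq> G. (-1) ^ card (G - S) * g G)"

text \<open>Expansion of \<open>(-1 + 1) ^ card A\<close>, with \<open>prod_add\<close> as the
  binomial theorem.\<close>

lemma sum_neg_one_power_Pow:
  "(\<Sum>T\<in>Pow (A :: 'a::finite set). (-1 :: real) ^ card T) = (if A = {} then 1 else 0)"
  using prod_add[of A "\<lambda>_. -1 :: real" "\<lambda>_. 1"] by (simp add: card_gt_0_iff power_0_left)

text \<open>Complementation in \<open>G\<close>, respectively removal of \<open>H\<close>, maps the
  interval bijectively onto \<open>Pow (G - H)\<close>. The first sign convention serves the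
  inversion formula, the second the inclusion-exclusion for traces.\<close>

lemma sum_neg_one_power_interval:
  fixes H G :: "'a::finite set"
  shows "(\<Sum>S | H \<subseteq> S \<and> S \<subseteq> G. (-1 :: real) ^ card (G - S)) = (if H = G then 1 else 0)"
    and "(\<Sum>S | H \<subseteq> S \<and> S \<subseteq> G. (-1 :: real) ^ card (S - H)) = (if H = G then 1 else 0)"
proof -
  have "(\<Sum>S | H \<subseteq> S \<and> S \<subseteq> G. (-1 :: real) ^ card (G - S)) = (if H = G then 1 else 0) \<and>
    (\<Sum>S | H \<subseteq> S \<and> S \<subseteq> G. (-1 :: real) ^ card (S - H)) = (if H = G then 1 else 0)"
  proof (cases "H \<subseteq> G")
    case True
    have "(\<Sum>S | H \<subseteq> S \<and> S \<subseteq> G. (-1 :: real) ^ card (G - S)) = (\<Sum>T\<in>Pow (G - H). (-1) ^ card T)"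
      by (rule sum.reindex_bij_witness[of _ "\<lambda>T. G - T" "\<lambda>S. G - S"])
        (use True in \<open>auto simp: double_diff\<close>)
    moreover have "(\<Sum>S | H \<subseteq> S \<and> S \<subseteq> G. (-1 :: real) ^ card (S - H)) = (\<Sum>T\<in>Pow (G - H). (-1) ^ card T)"
      by (rule sum.reindex_bij_witness[of _ "\<lambda>T. H \<union> T" "\<lambda>S. S - H"])
        (use True in \<open>auto simp: Un_Diff intro!: arg_cong[of _ _ card]\<close>)
    ultimately show ?thesis
      using True by (auto simp: sum_neg_one_power_Pow)
  qed (auto intro!: sum.neutral)
  then show "(\<Sum>S | H \<subseteq> S \<and> S \<subseteq> G. (-1 :: real) ^ card (G - S)) = (if H = G then 1 else 0)"
    and "(\<Sum>S | H \<subseteq> S \<and> S \<subseteq> G. (-1 :: real) ^ card (S - H)) = (if H = G then 1 else 0)"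
    by auto
qed

text \<open>After exchanging the two sums, the inner alternating sum runs over the interval from
  \<open>H\<close> to \<open>G\<close> and vanishes unless \<open>G = H\<close>.\<close>

lemma sum_moebius_supersets: "(\<Sum>S | H \<subseteq> S. moebius g S) = g H"
proof -
  have "(\<Sum>S | H \<subseteq> S. moebius g S) =
      (\<Sum>G\<in>UNIV. \<Sum>S | S \<in> {S. H \<subseteq> S} \<and> S \<subseteq> G. (-1) ^ card (G - S) * g G)"
    unfolding moebius_def
    using sum.swap_restrict[of "{S. H \<subseteq> S}" UNIV "\<lambda>S G. (-1) ^ card (G - S) * g G" "\<lambda>S G. S \<subseteq> G"]
    by simp
  also have "\<dots> = (\<Sum>G\<in>UNIV. (if H = G then 1 else 0) * g G)"
    by (simp add: sum_neg_one_power_interval flip: sum_distrib_right)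
  also have "\<dots> = g H"
    by (subst sum.remove[of _ H]) auto
  finally show ?thesis .
qed

text \<open>Expand \<open>g G\<close> by the inversion formula and exchange sums: for fixed
  \<open>S\<close> the sets \<open>G\<close> fill the interval from \<open>S0\<close> to
  \<open>F \<inter> S\<close>, so only those \<open>S\<close> with trace \<open>S0\<close> survive.
  The point is that the right-hand side involves \<open>g\<close> only on subsets of
  \<open>F\<close>.\<close>

lemma sum_moebius_trace:
  assumes "S0 \<subseteq> F"
  shows "(\<Sum>S | S \<inter> F = S0. moebius g S) = (\<Sum>G | S0 \<subseteq> G \<and> G \<subseteq> F. (-1) ^ card (G - S0) * g G)"
proof -
  have "(\<Sum>G | S0 \<subseteq> G \<and> G \<subseteq> F. (-1) ^ card (G - S0) * g G) =
      (\<Sum>G | S0 \<subseteq> G \<and> G \<subseteq> F. \<Sum>S | S \<in> UNIV \<and> G \<subseteq> S. (-1) ^ card (G - S0) * moebius g S)"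
    by (simp add: sum_moebius_supersets flip: sum_distrib_left)
  also have "\<dots> = (\<Sum>S\<in>UNIV. \<Sum>G | G \<in> {G. S0 \<subseteq> G \<and> G \<subseteq> F} \<and> G \<subseteq> S. (-1) ^ card (G - S0) * moebius g S)"
    by (rule sum.swap_restrict) auto
  also have "\<dots> = (\<Sum>S\<in>UNIV. (\<Sum>G | S0 \<subseteq> G \<and> G \<subseteq> F \<inter> S. (-1) ^ card (G - S0)) * moebius g S)"
    by (auto simp: sum_distrib_right intro!: sum.cong)
  also have "\<dots> = (\<Sum>S\<in>UNIV. if S \<inter> F = S0 then moebius g S else 0)"
    unfolding sum_neg_one_power_interval by (intro sum.cong) auto
  also have "\<dots> = (\<Sum>S | S \<inter> F = S0. moebius g S)"
    by (simp flip: sum.inter_filter)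
  finally show ?thesis by simp
qed

text \<open>Multiplicative \<open>g\<close> corresponds to independent coordinates: the alternating
  sum is the expansion of the product of \<open>1 - f i\<close> over the \<open>i\<close> outside
  \<open>S\<close>.\<close>

lemma moebius_prod: "moebius (\<lambda>G. \<Prod>i\<in>G. f i) S = (\<Prod>i\<in>UNIV. if i \<in> S then f i else 1 - f i)"
proof -
  have "moebius (\<lambda>G. \<Prod>i\<in>G. f i) S = (\<Sum>X\<in>Pow (- S). (-1) ^ card X * (\<Prod>i\<in>S \<union> X. f i))"
    unfolding moebius_def
    by (rule sum.reindex_bij_witness[of _ "\<lambda>X. S \<union> X" "\<lambda>G. G - S"])
      (auto intro!: arg_cong2[of _ _ _ _ "(*)"] arg_cong[of _ _ "\<lambda>X. (-1) ^ card X"] prod.cong)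
  also have "\<dots> = (\<Sum>X\<in>Pow (- S). (\<Prod>i\<in>S. f i) * ((\<Prod>i\<in>X. - f i) * (\<Prod>i\<in>- S - X. 1)))"
    by (intro sum.cong refl) (subst prod.union_disjoint, auto simp: prod_uminus)
  also have "\<dots> = (\<Prod>i\<in>S. f i) * (\<Prod>i\<in>- S. - f i + 1)"
    by (subst prod_add) (auto simp: sum_distrib_left)
  also have "\<dots> = (\<Prod>i\<in>S. if i \<in> S then f i else 1 - f i) * (\<Prod>i\<in>- S. if i \<in> S then f i else 1 - f i)"
    by (intro arg_cong2[of _ _ _ _ "(*)"] prod.cong) auto
  also have "\<dots> = (\<Prod>i\<in>UNIV. if i \<in> S then f i else 1 - f i)"
    by (subst prod.union_disjoint[symmetric]) auto
  finally show ?thesis .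
qed

lemma moebius_mult: "moebius (\<lambda>G. x * g G) S = x * moebius g S"
  by (simp add: moebius_def sum_distrib_left mult_ac)

text \<open>For small \<open>q\<close> the term \<open>G = S\<close> dominates where \<open>B\<close> is strictly increasing.\<close>

lemma eventually_moebius_powr_nonneg:
  fixes A B :: "'a::finite set \<Rightarrow> real"
  assumes "(A S > 0 \<and> (\<forall>G. S \<subset> G \<longrightarrow> B S < B G)) \<or> ((\<forall>G. S \<subset> G \<longrightarrow> B S = B G) \<and> moebius A S \<ge> 0)"
  shows "\<forall>\<^sub>F q in at_right 0. moebius (\<lambda>G. A G * q powr B G) S \<ge> 0"
  using assms
proof
  assume *: "A S > 0 \<and> (\<forall>G. S \<subset> G \<longrightarrow> B S < B G)"
  \<comment> \<open>After division by \<open>q powr B S\<close> every term with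
    \<open>G \<noteq> S\<close> has a positive exponent and dies out, so the limit is
    \<open>A S > 0\<close>.\<close>
  have "((\<lambda>q. moebius (\<lambda>G. A G * q powr (B G - B S)) S) \<longlongrightarrow>
     moebius (\<lambda>G. if G = S then A S else 0) S) (at_right 0)"
    unfolding moebius_def
  proof (intro tendsto_intros)
    fix G assume G: "G \<in> {G. S \<subseteq> G}"
    show "((\<lambda>q. A G * q powr (B G - B S)) \<longlongrightarrow> (if G = S then A S else 0)) (at_right 0)"
    proof (cases "G = S")
      case True
      have "\<forall>\<^sub>F q::real in at_right 0. A S = A S * q powr 0"
        using eventually_at_right_less[of 0] by eventually_elim simp
      then show ?thesis
        using True by (auto intro: Lim_transform_eventually[OF tendsto_const])
    next
      case False
      then have "B G - B S > 0"
        using * G by auto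
      then have "((\<lambda>q. q powr (B G - B S)) \<longlongrightarrow> 0) (at_right (0::real))"
        by real_asymp
      from tendsto_mult[OF tendsto_const[of "A G"] this] show ?thesis
        using False by simp
    qed
  qed
  moreover have "moebius (\<lambda>G. if G = S then A S else 0) S = A S"
    by (simp add: moebius_def if_distrib sum.delta cong: if_cong)
  ultimately have "\<forall>\<^sub>F q in at_right 0. moebius (\<lambda>G. A G * q powr (B G - B S)) S > 0"
    using * by (auto intro: order_tendstoD)
  then show ?thesis
    using eventually_at_right_less[of 0]
  proof eventually_elim
    case (elim q)
    have "moebius (\<lambda>G. A G * q powr B G) S = q powr B S * moebius (\<lambda>G. A G * q powr (B G - B S)) S"
      unfolding moebius_mult[symmetric] using elim(2)
      by (intro arg_cong[of _ _ "\<lambda>f. moebius f S"]) (auto simp: powr_diff)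
    then show ?case
      using elim by simp
  qed
next
  assume *: "(\<forall>G. S \<subset> G \<longrightarrow> B S = B G) \<and> moebius A S \<ge> 0"
  \<comment> \<open>All exponents above \<open>S\<close> agree, so the power factors out exactly and
    the sign is that of \<open>moebius A S\<close> for every \<open>q\<close>.\<close>
  have "moebius (\<lambda>G. A G * q powr B G) S = q powr B S * moebius A S" for q
    unfolding moebius_mult[symmetric] unfolding moebius_def
  proof (intro sum.cong refl)
    fix G assume "G \<in> {G. S \<subseteq> G}"
    with * have "B G = B S" by (cases "G = S") auto
    then show "(-1) ^ card (G - S) * (A G * q powr B G) = (-1) ^ card (G - S) * (q powr B S * A G)"
      by simp
  qed
  with * show ?thesis by simp
qed

text \<open>The inverse of the constant 1 is the indicator of \<open>S = UNIV\<close>. It replaces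
  the third part of \<open>NC\<close> in the later nesting steps, where the coefficient is 1 in
  place of \<open>a\<close>.\<close>

lemma moebius_one_nonneg: "moebius (\<lambda>_. 1) S \<ge> 0"
  using sum_neg_one_power_interval(2)[of S UNIV] by (simp add: moebius_def)

section \<open>Uniform measures on boxes\<close>

lemma borel_measurable_vec_lambda [measurable (raw)]:
  fixes f :: "'n::finite \<Rightarrow> 'a \<Rightarrow> real"
  assumes "\<And>i. f i \<in> borel_measurable M"
  shows "(\<lambda>x. \<chi> i. f i x) \<in> borel_measurable M"
  using assms
  by (subst borel_measurable_euclidean_space) (auto simp: Basis_vec_def inner_axis)

lemma borel_measurable_vec_nth' [measurable (raw)]:
  fixes f :: "'a \<Rightarrow> real^'n::finite"
  assumes "f \<in> borel_measurable M"
  shows "(\<lambda>x. f x $ i) \<in> borel_measurable M"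
  using borel_measurable_inner[OF assms borel_measurable_const[of "axis i 1"]]
  by (simp add: inner_axis)

lemma measure_eqI_cbox:
  fixes M N :: "(real^'n::finite) measure"
  assumes "sets M = sets borel" "sets N = sets borel" "emeasure M UNIV \<noteq> \<infinity>"
    and "\<And>a b. emeasure M (cbox a b) = emeasure N (cbox a b)"
  shows "M = N"
proof (rule measure_eqI_generator_eq)
  let ?E = "range (\<lambda>(a, b). cbox a b :: (real^'n) set)"
  show "Int_stable ?E"
    by (auto simp: Int_stable_def Int_interval)
  have "sets (borel :: (real^'n) measure) = sigma_sets UNIV ?E"
    unfolding borel_eq_atLeastAtMost by (simp add: interval_cbox_cart case_prod_beta')
  then show "sets M = sigma_sets UNIV ?E" "sets N = sigma_sets UNIV ?E"
    using assms by auto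
  let ?A = "\<lambda>n::nat. cbox (\<chi> i. - real n) (\<chi> i. real n) :: (real^'n) set"
  show "range ?A \<subseteq> ?E" by auto
  show "(\<Union>i. ?A i) = UNIV"
  proof safe
    fix x :: "real^'n"
    obtain n where "norm x \<le> real n" using real_arch_simple by blast
    then have "x \<in> ?A n"
      by (auto simp: mem_box_cart abs_le_iff intro: order_trans[OF component_le_norm_cart])
        (metis abs_le_iff component_le_norm_cart minus_le_iff order_trans)+
    then show "x \<in> (\<Union>i. ?A i)" by blast
  qed simp
  show "emeasure M (?A i) \<noteq> \<infinity>" for i
    using assms(3) emeasure_mono[of "?A i" UNIV M] assms(1) by (auto simp: top_unique)
qed (use assms in auto)

text \<open>Clipping each side length at 0 lets one product formula cover empty boxes too, so that
  intersections of boxes need no case distinction.\<close>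

lemma emeasure_lborel_cbox_cart:
  "emeasure lborel (cbox a b :: (real^'n::finite) set) = ennreal (\<Prod>i\<in>UNIV. max 0 (b $ i - a $ i))"
proof (cases "cbox a b = {}")
  case True
  then obtain i where "b $ i < a $ i"
    by (auto simp: interval_eq_empty_cart)
  then have "(\<Prod>i\<in>UNIV. max 0 (b $ i - a $ i)) = 0"
    by (intro prod_zero bexI[of _ i]) (auto simp: max_def)
  with True show ?thesis
    by (simp only: emeasure_empty ennreal_0)
next
  case False
  then have "a $ i \<le> b $ i" for i
    by (simp add: interval_ne_empty_cart)
  then have "(\<Prod>i\<in>UNIV. max 0 (b $ i - a $ i)) = measure lborel (cbox a b)"
    using False by (simp add: content_cbox_cart max_absorb2)
  then show ?thesis
    using emeasure_lborel_cbox_finite[of a b] by (simp add: emeasure_eq_ennreal_measure less_top)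
qed

abbreviation uniform_box :: "real^'n::finite \<Rightarrow> real^'n \<Rightarrow> (real^'n) measure" where
  "uniform_box l h \<equiv> uniform_measure lborel (cbox l h)"

abbreviation uniform_cube :: "(real^'n::finite) measure" where
  "uniform_cube \<equiv> uniform_box 0 1"

lemma emeasure_uniform_box:
  fixes l h :: "real^'n::finite"
  assumes "\<And>i. l $ i < h $ i"
  shows "emeasure (uniform_box l h) (cbox a b) =
    ennreal (\<Prod>i\<in>UNIV. max 0 (min (h $ i) (b $ i) - max (l $ i) (a $ i)) / (h $ i - l $ i))"
proof -
  have "0 < (\<Prod>i\<in>UNIV. max 0 (h $ i - l $ i))"
    using assms by (intro prod_pos) (simp add: less_max_iff_disj)
  moreover have "(\<Prod>i\<in>UNIV. max 0 (h $ i - l $ i)) = (\<Prod>i\<in>UNIV. h $ i - l $ i)"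
    using assms by (intro prod.cong) (auto simp: max_def less_imp_le not_le)
  ultimately show ?thesis
    by (simp add: Int_interval_cart interval_cbox_cart emeasure_lborel_cbox_cart divide_ennreal
        prod_nonneg prod_dividef)
qed

lemma prob_space_uniform_box:
  fixes l h :: "real^'n::finite"
  assumes "\<And>i. l $ i < h $ i"
  shows "prob_space (uniform_box l h)"
proof (rule prob_space_uniform_measure)
  show "emeasure lborel (cbox l h) \<noteq> 0"
    using assms by (auto simp: emeasure_lborel_cbox_cart ennreal_eq_0_iff not_le intro!: prod_pos)
qed (simp add: emeasure_lborel_cbox_cart)

lemma prob_space_uniform_cube: "prob_space (uniform_cube :: (real^'n::finite) measure)"
  by (rule prob_space_uniform_box) simp

lemma emeasure_uniform_cube:
  "emeasure (uniform_cube :: (real^'n::finite) measure) (cbox a b) =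
    ennreal (\<Prod>i\<in>UNIV. max 0 (min 1 (b $ i) - max 0 (a $ i)))"
  by (subst emeasure_uniform_box) auto

section \<open>Affine images of uniform boxes and recombination of their coordinates\<close>

definition affine_box :: "real^'n::finite \<Rightarrow> real^'n \<Rightarrow> real^'n \<Rightarrow> real^'n" where
  "affine_box l h x = (\<chi> i. l $ i + x $ i * (h $ i - l $ i))"

lemma measurable_affine_box [measurable]: "affine_box l h \<in> borel_measurable borel"
  unfolding affine_box_def by measurable

lemma vimage_affine_box:
  fixes l h :: "real^'n::finite"
  assumes "\<And>i. l $ i < h $ i"
  shows "affine_box l h -` cbox a b =
    cbox (\<chi> i. (a $ i - l $ i) / (h $ i - l $ i)) (\<chi> i. (b $ i - l $ i) / (h $ i - l $ i))"
  using assms by (auto simp: mem_box_cart affine_box_def field_simps)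

lemma image_affine_box:
  fixes l h :: "real^'n::finite"
  assumes "\<And>i. l $ i < h $ i"
  shows "affine_box l h ` cbox a b = cbox (affine_box l h a) (affine_box l h b)"
proof safe
  fix x assume x: "x \<in> cbox (affine_box l h a) (affine_box l h b)"
  let ?y = "\<chi> i. (x $ i - l $ i) / (h $ i - l $ i)"
  have "?y \<in> cbox a b"
    using x assms by (auto simp: mem_box_cart affine_box_def field_simps)
  moreover have "x = affine_box l h ?y"
    using assms by (simp add: affine_box_def vec_eq_iff less_imp_neq[symmetric])
  ultimately show "x \<in> affine_box l h ` cbox a b" by blast
qed (use assms in \<open>auto simp: mem_box_cart affine_box_def less_imp_le mult_right_mono\<close>)

lemma uniform_box_eq_distr:
  fixes l h :: "real^'n::finite"
  assumes lh: "\<And>i. l $ i < h $ i"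
  shows "uniform_box l h = distr uniform_cube borel (affine_box l h)"
proof (rule measure_eqI_cbox)
  interpret prob_space "uniform_box l h"
    using lh by (rule prob_space_uniform_box)
  show "emeasure (uniform_box l h) UNIV \<noteq> \<infinity>"
    using emeasure_space_1 by simp
  fix a b :: "real^'n"
  have "max 0 (min (h $ i) (b $ i) - max (l $ i) (a $ i)) / (h $ i - l $ i) =
    max 0 (min 1 ((b $ i - l $ i) / (h $ i - l $ i)) - max 0 ((a $ i - l $ i) / (h $ i - l $ i)))" for i
  proof -
    have d: "h $ i - l $ i > 0"
      using lh[of i] by simp
    have "min (h $ i) (b $ i) - max (l $ i) (a $ i) = min (h $ i - l $ i) (b $ i - l $ i) - max 0 (a $ i - l $ i)"
      by (auto simp: min_def max_def)
    with d show ?thesis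
      by (simp add: max_divide_distrib_right min_divide_distrib_right diff_divide_distrib)
  qed
  then show "emeasure (uniform_box l h) (cbox a b) =
      emeasure (distr uniform_cube borel (affine_box l h)) (cbox a b)"
    using lh
    by (simp add: emeasure_distr vimage_affine_box emeasure_uniform_cube emeasure_uniform_box
       del: emeasure_uniform_measure)
qed auto

definition blend :: "'n set \<Rightarrow> real^'n::finite \<Rightarrow> real^'n \<Rightarrow> real^'n" where
  "blend S x y = (\<chi> i. if i \<in> S then x $ i else y $ i)"

lemma measurable_blend [measurable]:
  "case_prod (blend S) \<in> borel_measurable (borel \<Otimes>\<^sub>M borel)"
  unfolding blend_def case_prod_beta' by measurable

text \<open>The coordinates of a uniform point are independent, so those in \<open>S\<close> may
  come from a second, independent sample. On a test box the mass splits into a factor for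
  \<open>S\<close> and one for its complement.\<close>

lemma distr_blend_uniform_cube:
  "distr (uniform_cube \<Otimes>\<^sub>M uniform_cube) borel (case_prod (blend S)) = (uniform_cube :: (real^'n::finite) measure)"
proof (rule measure_eqI_cbox[symmetric])
  interpret C: prob_space "uniform_cube :: (real^'n) measure"
    by (rule prob_space_uniform_cube)
  show "emeasure (uniform_cube :: (real^'n) measure) UNIV \<noteq> \<infinity>"
    using C.emeasure_space_1 by simp
  fix a b :: "real^'n"
  let ?X = "{x. \<forall>i\<in>S. a $ i \<le> x $ i \<and> x $ i \<le> b $ i}"
  let ?Y = "{x. \<forall>i\<in>-S. a $ i \<le> x $ i \<and> x $ i \<le> b $ i}"
  have [measurable]: "?X \<in> sets borel" "?Y \<in> sets borel"
    by measurable
  \<comment> \<open>Inside the cube the cylinder over the sides in \<open>S\<close> is a box, whose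
    mass is known.\<close>
  have "cbox 0 1 \<inter> ?X = cbox 0 1 \<inter> cbox (\<chi> i. if i \<in> S then a $ i else 0) (\<chi> i. if i \<in> S then b $ i else 1)"
    by (auto simp: mem_box_cart) (metis)+
  then have X: "emeasure uniform_cube ?X = ennreal (\<Prod>i\<in>UNIV. if i \<in> S then max 0 (min 1 (b $ i) - max 0 (a $ i)) else 1)"
    using emeasure_uniform_cube[of "\<chi> i. if i \<in> S then a $ i else 0" "\<chi> i. if i \<in> S then b $ i else 1"]
    by (simp add: if_distrib cong: if_cong)
  have "cbox 0 1 \<inter> ?Y = cbox 0 1 \<inter> cbox (\<chi> i. if i \<in> S then 0 else a $ i) (\<chi> i. if i \<in> S then 1 else b $ i)"
    by (auto simp: mem_box_cart) (metis)+
  then have Y: "emeasure uniform_cube ?Y = ennreal (\<Prod>i\<in>UNIV. if i \<in> S then 1 else max 0 (min 1 (b $ i) - max 0 (a $ i)))"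
    using emeasure_uniform_cube[of "\<chi> i. if i \<in> S then 0 else a $ i" "\<chi> i. if i \<in> S then 1 else b $ i"]
    by (simp add: if_distrib cong: if_cong)
  have "emeasure (distr (uniform_cube \<Otimes>\<^sub>M uniform_cube) borel (case_prod (blend S))) (cbox a b) =
      emeasure (uniform_cube \<Otimes>\<^sub>M uniform_cube) (?X \<times> ?Y)"
    by (subst emeasure_distr)
      (auto simp: space_pair_measure mem_box_cart blend_def split: if_splits intro!: arg_cong2[of _ _ _ _ emeasure])
  also have "\<dots> = emeasure uniform_cube ?X * emeasure uniform_cube ?Y"
    by (rule C.emeasure_pair_measure_Times) auto
  also have "\<dots> = emeasure uniform_cube (cbox a b)"
    unfolding X Y emeasure_uniform_cube
    by (subst ennreal_mult[symmetric])
      (auto simp: prod_nonneg intro!: arg_cong[of _ _ ennreal] prod.cong simp flip: prod.distrib)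
  finally show "emeasure uniform_cube (cbox a b) =
      emeasure (distr (uniform_cube \<Otimes>\<^sub>M uniform_cube) borel (case_prod (blend S))) (cbox a b)" ..
qed auto

section \<open>Mixtures\<close>

lemma space_mixture [simp]: "space (mixture I w M) = UNIV"
  using sets_eq_imp_space_eq[OF sets_mixture] by simp

declare sets_mixture [simp, measurable_cong]

lemma mixture_cong:
  assumes "I = J" "\<And>i. i \<in> J \<Longrightarrow> w i = v i" "\<And>i. i \<in> J \<Longrightarrow> M i = N i"
  shows "mixture I w M = mixture J v N"
  unfolding mixture_def using assms by (simp cong: sum.cong)

lemma mixture_eqI:
  assumes "sets N = sets borel" "\<And>i. i \<in> I \<Longrightarrow> sets (M i) = sets borel"
    and "\<And>A. A \<in> sets borel \<Longrightarrow> emeasure N A = (\<Sum>i\<in>I. w i * emeasure (M i) A)"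
  shows "N = mixture I w M"
  by (rule measure_eqI) (use assms in \<open>auto simp: emeasure_mixture\<close>)

lemma distr_mixture:
  fixes M :: "'i \<Rightarrow> 'a::topological_space measure" and f :: "'a \<Rightarrow> 'b::topological_space"
  assumes "\<And>i. i \<in> I \<Longrightarrow> sets (M i) = sets borel" "f \<in> borel_measurable borel"
  shows "distr (mixture I w M) borel f = mixture I w (\<lambda>i. distr (M i) borel f)"
proof (rule mixture_eqI)
  fix A :: "'b set" assume A: "A \<in> sets borel"
  have f: "f -` A \<in> sets borel"
    using measurable_sets[OF assms(2) A] by simp
  have "emeasure (distr (M i) borel f) A = emeasure (M i) (f -` A)" if "i \<in> I" for i
  proof -
    have "f \<in> borel_measurable (M i)" "space (M i) = UNIV"
      using assms(2) assms(1)[OF that] sets_eq_imp_space_eq[OF assms(1)[OF that]]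
      by (simp_all cong: measurable_cong_sets)
    with A show ?thesis
      by (simp add: emeasure_distr)
  qed
  then show "emeasure (distr (mixture I w M) borel f) A = (\<Sum>i\<in>I. w i * emeasure (distr (M i) borel f) A)"
    using A f assms by (simp add: emeasure_distr emeasure_mixture cong: measurable_cong_sets)
qed auto

lemma mixture_mixture:
  assumes "\<And>i j. i \<in> I \<Longrightarrow> j \<in> J \<Longrightarrow> sets (M i j) = sets borel"
  shows "mixture I w (\<lambda>i. mixture J v (M i)) = mixture (I \<times> J) (\<lambda>(i, j). w i * v j) (\<lambda>(i, j). M i j)"
  by (rule mixture_eqI)
    (use assms in \<open>auto simp: emeasure_mixture sum_distrib_left sum.cartesian_product mult.assoc intro!: sum.cong\<close>)

text \<open>Merges components that different labels have in common, such as equal boxes or equal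
  projections, by adding their weights.\<close>

lemma mixture_group:
  fixes K :: "'i \<Rightarrow> 'j" and M :: "'j \<Rightarrow> 'a::topological_space measure"
  assumes "finite I" "finite G" "K ` I \<subseteq> G" "\<And>J. J \<in> G \<Longrightarrow> sets (M J) = sets borel"
  shows "mixture I w (\<lambda>i. M (K i)) = mixture G (\<lambda>J. \<Sum>i | i \<in> I \<and> K i = J. w i) M"
proof (rule mixture_eqI)
  fix A :: "'a set" assume A: "A \<in> sets borel"
  have "(\<Sum>J\<in>G. (\<Sum>i | i \<in> I \<and> K i = J. w i) * emeasure (M J) A) =
      (\<Sum>J\<in>G. \<Sum>i | i \<in> I \<and> K i = J. w i * emeasure (M (K i)) A)"
    by (auto simp: sum_distrib_right intro!: sum.cong)
  also have "\<dots> = (\<Sum>i\<in>I. w i * emeasure (M (K i)) A)"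
    by (rule sum.group) (use assms in auto)
  finally show "emeasure (mixture I w (\<lambda>i. M (K i))) A =
      (\<Sum>J\<in>G. (\<Sum>i | i \<in> I \<and> K i = J. w i) * emeasure (M J) A)"
    using A assms by (subst emeasure_mixture) auto
qed (use assms in auto)

text \<open>The push-forward of a product is linear in the first factor: slice over the second
  factor by Fubini and apply \<open>emeasure_mixture\<close> to each slice.\<close>

lemma distr_pair_mixture_left:
  fixes K :: "'i \<Rightarrow> 'a::topological_space measure" and N :: "'b::topological_space measure"
  assumes K: "\<And>i. i \<in> I \<Longrightarrow> sets (K i) = sets borel" "\<And>i. i \<in> I \<Longrightarrow> prob_space (K i)"
    and M: "prob_space (mixture I w K)" and N: "prob_space N" "sets N = sets borel"
    and f: "(f :: _ \<Rightarrow> 'c::topological_space) \<in> borel_measurable (borel \<Otimes>\<^sub>M borel)"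
  shows "distr (mixture I w K \<Otimes>\<^sub>M N) borel f = mixture I w (\<lambda>i. distr (K i \<Otimes>\<^sub>M N) borel f)"
proof (rule mixture_eqI)
  fix A :: "'c set" assume A: "A \<in> sets borel"
  interpret N: prob_space N by fact
  have sp: "space N = UNIV"
    using sets_eq_imp_space_eq[OF N(2)] by simp
  have fA: "f -` A \<in> sets (borel \<Otimes>\<^sub>M borel)"
    using measurable_sets[OF f A] by (simp add: space_pair_measure)
  have *: "emeasure (distr (M \<Otimes>\<^sub>M N) borel f) A = (\<integral>\<^sup>+y. emeasure M ((\<lambda>x. (x, y)) -` (f -` A)) \<partial>N)"
    if M: "prob_space M" "sets M = sets borel" for M
  proof -
    interpret M: prob_space M by fact
    interpret MN: pair_sigma_finite M N
      by (simp add: M.sigma_finite_measure_axioms N.sigma_finite_measure_axioms pair_sigma_finite_def)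
    have s: "sets (M \<Otimes>\<^sub>M N) = sets (borel \<Otimes>\<^sub>M borel)"
      using M N by (intro sets_pair_measure_cong)
    then have f': "f \<in> borel_measurable (M \<Otimes>\<^sub>M N)"
      using f by (simp cong: measurable_cong_sets)
    have "space (M \<Otimes>\<^sub>M N) = UNIV"
      using sets_eq_imp_space_eq[OF s] by (simp add: space_pair_measure)
    then have "emeasure (distr (M \<Otimes>\<^sub>M N) borel f) A = emeasure (M \<Otimes>\<^sub>M N) (f -` A)"
      using f' A by (simp add: emeasure_distr)
    also have "\<dots> = (\<integral>\<^sup>+y. emeasure M ((\<lambda>x. (x, y)) -` (f -` A)) \<partial>N)"
      using fA s by (intro MN.emeasure_pair_measure_alt2) simp
    finally show ?thesis .
  qed
  have sec: "(\<lambda>x. (x, y)) -` (f -` A) \<in> sets borel" for y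
    using sets_Pair2[OF fA, of y] .
  have meas: "(\<lambda>y. emeasure (K i) ((\<lambda>x. (x, y)) -` (f -` A))) \<in> borel_measurable N" if i: "i \<in> I" for i
  proof -
    interpret M: prob_space "K i" using K i by auto
    interpret MN: pair_sigma_finite "K i" N
      by (simp add: M.sigma_finite_measure_axioms N.sigma_finite_measure_axioms pair_sigma_finite_def)
    have s: "sets (K i \<Otimes>\<^sub>M N) = sets (borel \<Otimes>\<^sub>M borel)"
      using K i N by (intro sets_pair_measure_cong) auto
    then show ?thesis
      using fA by (intro MN.measurable_emeasure_Pair2) simp
  qed
  have "emeasure (distr (mixture I w K \<Otimes>\<^sub>M N) borel f) A =
      (\<integral>\<^sup>+y. (\<Sum>i\<in>I. w i * emeasure (K i) ((\<lambda>x. (x, y)) -` (f -` A))) \<partial>N)"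
    unfolding *[OF M sets_mixture] using K sec
    by (intro nn_integral_cong emeasure_mixture) auto
  also have "\<dots> = (\<Sum>i\<in>I. w i * emeasure (distr (K i \<Otimes>\<^sub>M N) borel f) A)"
    using meas K by (subst nn_integral_sum) (auto simp: nn_integral_cmult * intro!: sum.cong)
  finally show "emeasure (distr (mixture I w K \<Otimes>\<^sub>M N) borel f) A =
      (\<Sum>i\<in>I. w i * emeasure (distr (K i \<Otimes>\<^sub>M N) borel f) A)" .
qed auto

lemma distr_pair_mixture_right:
  fixes K :: "'i \<Rightarrow> 'a::topological_space measure" and N :: "'b::topological_space measure"
  assumes K: "\<And>i. i \<in> I \<Longrightarrow> sets (K i) = sets borel" "\<And>i. i \<in> I \<Longrightarrow> prob_space (K i)"
    and M: "prob_space (mixture I w K)" and N: "prob_space N" "sets N = sets borel"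
    and f: "(f :: _ \<Rightarrow> 'c::topological_space) \<in> borel_measurable (borel \<Otimes>\<^sub>M borel)"
  shows "distr (N \<Otimes>\<^sub>M mixture I w K) borel f = mixture I w (\<lambda>i. distr (N \<Otimes>\<^sub>M K i) borel f)"
proof -
  have f': "(\<lambda>(x, y). f (y, x)) \<in> borel_measurable (borel \<Otimes>\<^sub>M borel)"
    using measurable_compose[OF measurable_pair_swap' f] by (simp add: case_prod_beta')
  have swap: "distr (N \<Otimes>\<^sub>M M) borel f = distr (M \<Otimes>\<^sub>M N) borel (\<lambda>(x, y). f (y, x))"
    if M: "prob_space M" "sets M = sets borel" for M
  proof -
    interpret M: prob_space M by fact
    interpret N: prob_space N by fact
    interpret MN: pair_sigma_finite N M
      by (simp add: M.sigma_finite_measure_axioms N.sigma_finite_measure_axioms pair_sigma_finite_def)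
    have "sets (N \<Otimes>\<^sub>M M) = sets (borel \<Otimes>\<^sub>M borel)"
      using M N by (intro sets_pair_measure_cong)
    then have "f \<in> borel_measurable (N \<Otimes>\<^sub>M M)"
      using f by (simp cong: measurable_cong_sets)
    then show ?thesis
      by (subst MN.distr_pair_swap, subst distr_distr) (auto simp: comp_def case_prod_beta')
  qed
  have "distr (N \<Otimes>\<^sub>M mixture I w K) borel f = distr (mixture I w K \<Otimes>\<^sub>M N) borel (\<lambda>(x, y). f (y, x))"
    by (rule swap[OF M sets_mixture])
  also have "\<dots> = mixture I w (\<lambda>i. distr (K i \<Otimes>\<^sub>M N) borel (\<lambda>(x, y). f (y, x)))"
    by (rule distr_pair_mixture_left) (use assms f' in auto)
  also have "\<dots> = mixture I w (\<lambda>i. distr (N \<Otimes>\<^sub>M K i) borel f)"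
    by (rule mixture_cong) (use swap K in auto)
  finally show ?thesis .
qed

section \<open>Vertex measures\<close>

definition vertex_lower :: "real^'n::finite \<Rightarrow> 'n vertex \<Rightarrow> real^'n" where
  "vertex_lower u \<nu> = (\<chi> i. if \<nu> $ i then u $ i else 0)"

definition vertex_upper :: "real^'n::finite \<Rightarrow> 'n vertex \<Rightarrow> real^'n" where
  "vertex_upper u \<nu> = (\<chi> i. if \<nu> $ i then 1 else u $ i)"

lemma vertex_box_eq: "vertex_box u \<nu> = cbox (vertex_lower u \<nu>) (vertex_upper u \<nu>)"
  by (simp add: vertex_box_def vertex_lower_def vertex_upper_def)

definition interior_point :: "real^'n::finite \<Rightarrow> bool" where
  "interior_point u \<longleftrightarrow> (\<forall>i. 0 < u $ i \<and> u $ i < 1)"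

lemma vertex_lower_less_upper:
  "interior_point u \<Longrightarrow> vertex_lower u \<nu> $ i < vertex_upper u \<nu> $ i"
  by (auto simp: interior_point_def vertex_lower_def vertex_upper_def)

lemma vertex_lower_nonneg: "interior_point u \<Longrightarrow> 0 \<le> vertex_lower u \<nu> $ i"
  by (auto simp: interior_point_def vertex_lower_def less_imp_le)

lemma vertex_upper_le_1: "interior_point u \<Longrightarrow> vertex_upper u \<nu> $ i \<le> 1"
  by (auto simp: interior_point_def vertex_upper_def less_imp_le)

lemma prob_space_vertex_box:
  "interior_point u \<Longrightarrow> prob_space (uniform_measure lborel (vertex_box u \<nu>))"
  unfolding vertex_box_eq by (intro prob_space_uniform_box vertex_lower_less_upper)

lemma sets_vertex_measure [simp, measurable_cong]: "sets (vertex_measure u z) = sets borel"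
  by (simp add: vertex_measure_def)

lemma space_vertex_measure [simp]: "space (vertex_measure u z) = UNIV"
  by (simp add: vertex_measure_def)

lemma emeasure_vertex_measure:
  "A \<in> sets borel \<Longrightarrow> emeasure (vertex_measure u z) A =
    (\<Sum>\<nu>\<in>UNIV. ennreal (z \<nu>) * emeasure (uniform_measure lborel (vertex_box u \<nu>)) A)"
  unfolding vertex_measure_def by (rule emeasure_mixture) auto

definition vertex_weights :: "('n::finite vertex \<Rightarrow> real) \<Rightarrow> bool" where
  "vertex_weights z \<longleftrightarrow> (\<forall>\<nu>. 0 \<le> z \<nu>) \<and> (\<Sum>\<nu>\<in>UNIV. z \<nu>) = 1"

lemma prob_space_vertex_measure:
  assumes u: "interior_point u" and z: "vertex_weights z"
  shows "prob_space (vertex_measure u z)"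
proof
  have "emeasure (uniform_measure lborel (vertex_box u \<nu>)) UNIV = 1" for \<nu>
    using prob_space.emeasure_space_1[OF prob_space_vertex_box[OF u]] by simp
  then show "emeasure (vertex_measure u z) (space (vertex_measure u z)) = 1"
    using z by (simp add: emeasure_vertex_measure vertex_weights_def sum_ennreal
        del: emeasure_uniform_measure)
qed

definition vertex_volume :: "real^'n::finite \<Rightarrow> 'n vertex \<Rightarrow> real" where
  "vertex_volume u \<nu> = (\<Prod>i\<in>UNIV. if \<nu> $ i then 1 - u $ i else u $ i)"

lemma vertex_volume_nonneg: "interior_point u \<Longrightarrow> 0 \<le> vertex_volume u \<nu>"
  by (auto simp: vertex_volume_def interior_point_def less_imp_le intro!: prod_nonneg)

lemma sum_vertices_prod:
  fixes f g :: "'n::finite \<Rightarrow> 'a::comm_semiring_1"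
  shows "(\<Sum>\<nu>\<in>(UNIV :: 'n vertex set). \<Prod>i\<in>UNIV. if \<nu> $ i then f i else g i) = (\<Prod>i\<in>UNIV. f i + g i)"
proof -
  have "(\<Sum>\<nu>\<in>(UNIV :: 'n vertex set). \<Prod>i\<in>UNIV. if \<nu> $ i then f i else g i) =
      (\<Sum>X\<in>UNIV. \<Prod>i\<in>UNIV. if i \<in> X then f i else g i)"
    by (rule sum.reindex_bij_witness[of _ "\<lambda>X. \<chi> i. i \<in> X" "\<lambda>\<nu>. {i. \<nu> $ i}"]) (auto simp: vec_eq_iff)
  also have "\<dots> = (\<Sum>X\<in>Pow UNIV. (\<Prod>i\<in>X. f i) * (\<Prod>i\<in>UNIV - X. g i))"
    by (auto simp: prod.If_cases Compl_eq_Diff_UNIV intro!: sum.cong)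
  also have "\<dots> = (\<Prod>i\<in>UNIV. f i + g i)"
    by (rule prod_add[symmetric]) simp
  finally show ?thesis .
qed

lemma vertex_weights_volume:
  assumes "interior_point u"
  shows "vertex_weights (vertex_volume u)"
  using assms by (simp add: vertex_weights_def vertex_volume_nonneg)
    (simp add: vertex_volume_def sum_vertices_prod)

text \<open>The decomposition at \<open>u\<close> splits the uniform measure into uniform measures
  on the boxes, weighted by volume. On a test box this is the expansion of a product whose factors
  are the overlaps below and above \<open>u $ i\<close>.\<close>

lemma uniform_cube_eq_vertex_measure:
  fixes u :: "real^'n::finite"
  assumes u: "interior_point u"
  shows "uniform_cube = vertex_measure u (vertex_volume u)"
proof (rule measure_eqI_cbox)
  interpret U: prob_space "uniform_cube :: (real^'n) measure"
    by (rule prob_space_uniform_cube)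
  show "emeasure (uniform_cube :: (real^'n) measure) UNIV \<noteq> \<infinity>"
    using U.emeasure_space_1 by (simp del: emeasure_uniform_measure)
  fix a b :: "real^'n"
  \<comment> \<open>The length of the overlap of \<open>[l, h]\<close> with the \<open>i\<close>-th
    side of the test box.\<close>
  define L where "L l h i = max 0 (min h (b $ i) - max l (a $ i))" for l h i
  have "ennreal (vertex_volume u \<nu>) * emeasure (uniform_measure lborel (vertex_box u \<nu>)) (cbox a b) =
      ennreal (\<Prod>i\<in>UNIV. if \<nu> $ i then L (u $ i) 1 i else L 0 (u $ i) i)" for \<nu>
  proof -
    have "emeasure (uniform_measure lborel (vertex_box u \<nu>)) (cbox a b) =
      ennreal (\<Prod>i\<in>UNIV. if \<nu> $ i then L (u $ i) 1 i / (1 - u $ i) else L 0 (u $ i) i / u $ i)"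
      unfolding vertex_box_eq emeasure_uniform_box[OF vertex_lower_less_upper[OF u]]
      by (auto simp: vertex_lower_def vertex_upper_def L_def intro!: arg_cong[of _ _ ennreal] prod.cong)
    then have "ennreal (vertex_volume u \<nu>) * emeasure (uniform_measure lborel (vertex_box u \<nu>)) (cbox a b) =
      ennreal (\<Prod>i\<in>UNIV. (if \<nu> $ i then 1 - u $ i else u $ i) *
         (if \<nu> $ i then L (u $ i) 1 i / (1 - u $ i) else L 0 (u $ i) i / u $ i))"
      using vertex_volume_nonneg[OF u, of \<nu>]
      by (simp add: vertex_volume_def prod.distrib ennreal_mult' del: emeasure_uniform_measure)
    also have "\<dots> = ennreal (\<Prod>i\<in>UNIV. if \<nu> $ i then L (u $ i) 1 i else L 0 (u $ i) i)"
    proof (intro arg_cong[of _ _ ennreal] prod.cong refl)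
      fix i
      have "u $ i \<noteq> 0" "u $ i \<noteq> 1" using u by (auto simp: interior_point_def less_le)
      then show "(if \<nu> $ i then 1 - u $ i else u $ i) *
         (if \<nu> $ i then L (u $ i) 1 i / (1 - u $ i) else L 0 (u $ i) i / u $ i) =
         (if \<nu> $ i then L (u $ i) 1 i else L 0 (u $ i) i)"
        by auto
    qed
    finally show ?thesis .
  qed
  then have "emeasure (vertex_measure u (vertex_volume u)) (cbox a b) =
      (\<Sum>\<nu>\<in>UNIV. ennreal (\<Prod>i\<in>UNIV. if \<nu> $ i then L (u $ i) 1 i else L 0 (u $ i) i))"
    by (simp add: emeasure_vertex_measure del: emeasure_uniform_measure)
  also have "\<dots> = ennreal (\<Prod>i\<in>UNIV. L (u $ i) 1 i + L 0 (u $ i) i)"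
    by (subst sum_ennreal) (auto simp: sum_vertices_prod L_def intro!: prod_nonneg)
  also have "(\<Prod>i\<in>UNIV. L (u $ i) 1 i + L 0 (u $ i) i) = (\<Prod>i\<in>UNIV. L 0 1 i)"
  proof (rule prod.cong[OF refl])
    show "L (u $ i) 1 i + L 0 (u $ i) i = L 0 1 i" for i
      using u[unfolded interior_point_def, rule_format, of i] by (auto simp: L_def min_def max_def)
  qed
  also have "ennreal (\<Prod>i\<in>UNIV. L 0 1 i) = emeasure uniform_cube (cbox a b)"
    unfolding emeasure_uniform_cube L_def ..
  finally show "emeasure uniform_cube (cbox a b) = emeasure (vertex_measure u (vertex_volume u)) (cbox a b)" ..
qed auto

section \<open>Tail nesting as a random substitution\<close>

lemma proj_along_front_face: "proj_along (front_face \<nu>) x = (\<chi> i. if \<nu> $ i then 0 else x $ i)"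
  by (simp add: proj_along_def face_vertex_front_face)

lemma proj_along_compl_front_face:
  "proj_along (compl_face (front_face \<nu>)) x = (\<chi> i. if \<nu> $ i then x $ i else 0)"
  by (simp add: compl_face_def proj_along_front_face face_vertex_front_face compl_vertex_def vec_eq_iff)

lemma measurable_proj_along [measurable]: "proj_along F \<in> borel_measurable borel"
  unfolding proj_along_def by measurable

text \<open>The two summands in \<open>partial_copula\<close> lie on complementary faces, so adding
  them selects each coordinate from one factor: the uniform one where \<open>\<nu>\<close> is true,
  the vertex measure elsewhere.\<close>

lemma partial_copula_eq:
  assumes u: "interior_point u" and z: "vertex_weights z"
  shows "partial_copula u z \<nu> =
    distr (uniform_cube \<Otimes>\<^sub>M vertex_measure u z) borel (case_prod (blend {i. \<nu> $ i}))"
proof -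
  let ?V = "vertex_measure u z"
  let ?U = "uniform_cube :: (real^'a) measure"
  let ?F = "front_face \<nu>"
  interpret V: prob_space ?V using u z by (rule prob_space_vertex_measure)
  interpret U: prob_space ?U by (rule prob_space_uniform_cube)
  interpret VU: pair_sigma_finite ?V ?U
    by (simp add: pair_sigma_finite_def V.sigma_finite_measure_axioms U.sigma_finite_measure_axioms)
  have [measurable]: "proj_along F \<in> borel_measurable ?V" "proj_along F \<in> borel_measurable ?U" for F
    by (auto cong: measurable_cong_sets)
  have "prob_space (distr ?U borel (proj_along (compl_face ?F)))"
    by (rule U.prob_space_distr) measurable
  then have "partial_copula u z \<nu> =
      distr (distr (?V \<Otimes>\<^sub>M ?U) (borel \<Otimes>\<^sub>M borel) (\<lambda>(x, y). (proj_along ?F x, proj_along (compl_face ?F) y)))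
        borel (\<lambda>(x, y). x + y)"
    unfolding partial_copula_def uniform_face_def face_marginal_def
    by (subst pair_measure_distr) (auto simp: prob_space_imp_sigma_finite)
  also have "\<dots> = distr (?V \<Otimes>\<^sub>M ?U) borel ((\<lambda>(x, y). x + y) \<circ> (\<lambda>(x, y). (proj_along ?F x, proj_along (compl_face ?F) y)))"
    by (rule distr_distr) measurable
  also have "(\<lambda>(x, y). x + y) \<circ> (\<lambda>(x, y). (proj_along ?F x, proj_along (compl_face ?F) y)) =
      (\<lambda>(x, y). blend {i. \<nu> $ i} y x)"
    by (auto simp: fun_eq_iff proj_along_front_face proj_along_compl_front_face blend_def vec_eq_iff)
  also have "distr (?V \<Otimes>\<^sub>M ?U) borel (\<lambda>(x, y). blend {i. \<nu> $ i} y x) =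
      distr (?U \<Otimes>\<^sub>M ?V) borel (case_prod (blend {i. \<nu> $ i}))"
    by (subst VU.distr_pair_swap, subst distr_distr) (auto simp: comp_def case_prod_beta' intro!: measurable_compose[OF _ measurable_blend])
  finally show ?thesis .
qed

text \<open>Pointwise form of one nesting step: \<open>s\<close> is the upper corner of the grid box
  at the origin, \<open>x\<close> the current point and \<open>y\<close> a fresh sample.\<close>

definition tail_subst :: "real^'n::finite \<Rightarrow> real^'n \<Rightarrow> real^'n \<Rightarrow> real^'n" where
  "tail_subst s x y = (\<chi> i. if x $ i < s $ i then s $ i * y $ i else x $ i)"

lemma measurable_tail_subst [measurable]:
  "case_prod (tail_subst s) \<in> borel_measurable (borel \<Otimes>\<^sub>M borel)"
  unfolding tail_subst_def case_prod_beta' by measurable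

text \<open>All that nesting sees of a grid box: each factor is either the first interval of its
  axis, ending at the scale \<open>s\<close>, or lies beyond the scale.\<close>

definition tail_box :: "real^'n::finite \<Rightarrow> (real^'n) set \<Rightarrow> bool" where
  "tail_box s J \<longleftrightarrow>
     (\<exists>l h. J = cbox l h \<and> (\<forall>i. l $ i < h $ i \<and> (l $ i = 0 \<and> h $ i = s $ i \<or> s $ i \<le> l $ i)))"

lemma grid_map_cbox:
  assumes "\<And>i. l $ i < h $ i"
  shows "grid_map (cbox l h) = affine_box l h"
proof -
  have "cbox l h \<noteq> {}"
    using assms by (simp add: interval_ne_empty_cart less_imp_le)
  then show ?thesis
    by (simp add: grid_map_def affine_box_def fun_eq_iff)
qed

lemma grid_vertex_cbox:
  assumes "\<And>i. l $ i < h $ i"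
  shows "grid_vertex (cbox l h) $ i \<longleftrightarrow> \<not> (l $ i \<le> 0 \<and> 0 \<le> h $ i)"
proof -
  have "(0 \<in> (\<lambda>x. x $ i) ` cbox l h) \<longleftrightarrow> l $ i \<le> 0 \<and> 0 \<le> h $ i"
  proof
    assume "l $ i \<le> 0 \<and> 0 \<le> h $ i"
    then have "(\<chi> j. if j = i then 0 else l $ j) \<in> cbox l h"
      using assms by (auto simp: mem_box_cart less_imp_le)
    then show "0 \<in> (\<lambda>x. x $ i) ` cbox l h"
      by (intro image_eqI[of _ _ "\<chi> j. if j = i then 0 else l $ j"]) auto
  next
    assume "0 \<in> (\<lambda>x. x $ i) ` cbox l h"
    then obtain x where x: "0 = x $ i" "x \<in> cbox l h" by blast
    then have "l $ i \<le> x $ i \<and> x $ i \<le> h $ i"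
      unfolding mem_box_cart by blast
    with x show "l $ i \<le> 0 \<and> 0 \<le> h $ i" by simp
  qed
  then show ?thesis by (simp add: grid_vertex_def)
qed

text \<open>The boundary of a box is null; this disposes of ties between a coordinate and a division
  point.\<close>

lemma AE_uniform_box:
  "AE x in uniform_box l h. x \<in> box l (h :: real^'n::finite)"
proof (rule AE_uniform_measureI)
  have "AE x in lborel. x \<notin> cbox l h - box l h"
    by (rule AE_not_in) (simp add: null_sets_def emeasure_Diff box_subset_cbox emeasure_lborel_cbox_eq emeasure_lborel_box_eq)
  then show "AE x in lborel. x \<in> cbox l h \<longrightarrow> x \<in> box l h"
    by eventually_elim auto
qed simp

text \<open>Parametrise \<open>J\<close> by a uniform point of the cube. Off the boundary, a
  coordinate whose factor is a first interval lies below \<open>s\<close> and is replaced by the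
  rescaled sample, just as \<open>grid_map J\<close> places it; a coordinate whose factor lies
  beyond \<open>s\<close> is kept and stays uniform. This is the blend that describes
  \<open>partial_copula\<close>.\<close>

lemma distr_tail_subst_box:
  assumes u: "interior_point u" and z: "vertex_weights z"
    and s: "\<And>i. 0 < s $ i" and J: "tail_box s J"
  shows "distr (uniform_measure lborel J \<Otimes>\<^sub>M vertex_measure u z) borel (case_prod (tail_subst s)) =
    distr (partial_copula u z (grid_vertex J)) borel (grid_map J)"
proof -
  obtain l h where Jlh: "J = cbox l h" and lh: "\<And>i. l $ i < h $ i"
    and tail: "\<And>i. l $ i = 0 \<and> h $ i = s $ i \<or> s $ i \<le> l $ i"
    using J unfolding tail_box_def by blast
  let ?V = "vertex_measure u z"
  let ?U = "uniform_cube :: (real^'a) measure"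
  interpret V: prob_space ?V using u z by (rule prob_space_vertex_measure)
  interpret U: prob_space ?U by (rule prob_space_uniform_cube)
  interpret UV: pair_sigma_finite ?U ?V
    by (simp add: pair_sigma_finite_def V.sigma_finite_measure_axioms U.sigma_finite_measure_axioms)
  let ?S = "{i. grid_vertex J $ i}"
  \<comment> \<open>The kept coordinates are those whose factor avoids 0, since \<open>s\<close> is
    positive.\<close>
  have S: "i \<in> ?S \<longleftrightarrow> s $ i \<le> l $ i" for i
    using tail[of i] s[of i] lh[of i] by (auto simp: Jlh grid_vertex_cbox[OF lh])
  have [measurable]: "affine_box l h \<in> borel_measurable ?U"
    by (auto cong: measurable_cong_sets)
  have "distr (uniform_measure lborel J \<Otimes>\<^sub>M ?V) borel (case_prod (tail_subst s)) =
      distr (distr ?U borel (affine_box l h) \<Otimes>\<^sub>M distr ?V borel (\<lambda>y. y)) borel (case_prod (tail_subst s))"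
    by (simp add: Jlh uniform_box_eq_distr[OF lh] distr_id2)
  also have "\<dots> = distr (?U \<Otimes>\<^sub>M ?V) borel (case_prod (tail_subst s) \<circ> (\<lambda>(x, y). (affine_box l h x, y)))"
    by (subst pair_measure_distr, simp, simp, simp add: distr_id2 V.sigma_finite_measure_axioms)
      (rule distr_distr; measurable)
  also have "\<dots> = distr (?U \<Otimes>\<^sub>M ?V) borel (affine_box l h \<circ> case_prod (blend ?S))"
  proof (rule distr_cong_AE)
    have "AE x in ?U \<Otimes>\<^sub>M ?V. fst x \<in> box 0 1"
    proof (rule UV.AE_pair_measure)
      show "{p \<in> space (?U \<Otimes>\<^sub>M ?V). fst p \<in> box 0 1} \<in> sets (?U \<Otimes>\<^sub>M ?V)"
        by measurable
    qed (use AE_uniform_box in auto)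
    then show "AE x in ?U \<Otimes>\<^sub>M ?V. (case_prod (tail_subst s) \<circ> (\<lambda>(x, y). (affine_box l h x, y))) x =
      (affine_box l h \<circ> case_prod (blend ?S)) x"
    proof eventually_elim
      case (elim p)
      obtain x y where p: "p = (x, y)" by force
      have x: "0 < x $ i" "x $ i < 1" for i
        using elim by (auto simp: p mem_box_cart)
      have "tail_subst s (affine_box l h x) y $ i = affine_box l h (blend ?S x y) $ i" for i
      proof (cases "i \<in> ?S")
        case True
        then have "s $ i \<le> l $ i" using S by simp
        moreover have "0 < x $ i * (h $ i - l $ i)" using x lh[of i] by simp
        ultimately show ?thesis
          using True by (simp add: tail_subst_def affine_box_def blend_def)
      next
        case False
        then have "l $ i = 0" "h $ i = s $ i" using S[of i] tail[of i] by auto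
        then show ?thesis
          using False x[of i] s[of i] by (simp add: tail_subst_def affine_box_def blend_def)
      qed
      then show ?case
        by (simp add: p vec_eq_iff)
    qed
  qed auto
  also have "\<dots> = distr (partial_copula u z (grid_vertex J)) borel (grid_map J)"
    unfolding partial_copula_eq[OF u z]
    by (simp add: Jlh grid_map_cbox[OF lh]) (subst distr_distr; simp)
  finally show ?thesis .
qed

section \<open>Grids adapted to a scale, and their invariance under nesting\<close>

definition tail_grid :: "real^'n::finite \<Rightarrow> (real^'n) set set \<Rightarrow> bool" where
  "tail_grid s G \<longleftrightarrow> finite G \<and> (\<forall>J\<in>G. tail_box s J) \<and>
     (\<forall>J\<in>G. \<forall>J'\<in>G. J \<noteq> J' \<longrightarrow> interior J \<inter> interior J' = {})"

text \<open>The weights are left open; on a \<open>tail_grid\<close> they turn out to be the masses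
  of the boxes, see \<open>tnest_eq_distr\<close>.\<close>

definition grid_uniform :: "(real^'n::finite) set set \<Rightarrow> (real^'n) measure \<Rightarrow> bool" where
  "grid_uniform G c \<longleftrightarrow> (\<exists>W. c = mixture G W (uniform_measure lborel))"

lemma grid_uniformI: "c = mixture G W (uniform_measure lborel) \<Longrightarrow> grid_uniform G c"
  unfolding grid_uniform_def by blast

lemma tail_boxE:
  assumes "tail_box s J"
  obtains l h where "J = cbox l h" "\<And>i. l $ i < h $ i"
    "\<And>i. l $ i = 0 \<and> h $ i = s $ i \<or> s $ i \<le> l $ i"
  using assms unfolding tail_box_def by blast

lemma tail_gridD:
  assumes "tail_grid s G"
  shows "finite G" "J \<in> G \<Longrightarrow> tail_box s J"
    "J \<in> G \<Longrightarrow> J' \<in> G \<Longrightarrow> J \<noteq> J' \<Longrightarrow> interior J \<inter> interior J' = {}"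
  using assms by (auto simp: tail_grid_def)

lemma emeasure_uniform_tail_box_self:
  assumes "tail_box s J"
  shows "prob_space (uniform_measure lborel J)" "emeasure (uniform_measure lborel J) J = 1"
proof -
  obtain l h where J: "J = cbox l h" "\<And>i. l $ i < h $ i"
    using assms by (rule tail_boxE) blast
  have pos: "emeasure lborel (cbox l h) \<noteq> 0"
    using J by (auto simp: emeasure_lborel_cbox_cart ennreal_eq_0_iff not_le intro!: prod_pos)
  show "prob_space (uniform_measure lborel J)"
    unfolding J(1) using J(2) by (rule prob_space_uniform_box)
  show "emeasure (uniform_measure lborel J) J = 1"
    unfolding J(1) using pos by (intro emeasure_uniform_measure_1) (auto simp: emeasure_lborel_cbox_cart)
qed

lemma emeasure_uniform_tail_box_other:
  assumes "tail_box s J" "tail_box s J'" "interior J \<inter> interior J' = {}"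
  shows "emeasure (uniform_measure lborel J) J' = 0"
proof -
  obtain l h l' h' where J: "J = cbox l h" "J' = cbox l' h'"
    using assms(1,2) unfolding tail_box_def by blast
  obtain a b where ab: "J \<inter> J' = cbox a b"
    unfolding J Int_interval by blast
  have "interior (cbox a b) = {}"
    using assms(3) unfolding interior_Int[symmetric] ab .
  then have "measure lborel (cbox a b) = 0"
    by (simp only: content_eq_0_interior)
  then have "emeasure lborel (cbox a b) = 0"
    using emeasure_lborel_cbox_finite[of a b] by (simp add: emeasure_eq_ennreal_measure less_top)
  then show ?thesis
    using J ab by simp
qed

text \<open>Both sides are mixtures over the boxes with the same components by
  \<open>distr_tail_subst_box\<close>; the weights agree because distinct boxes overlap in null
  sets.\<close>

lemma tnest_eq_distr:
  assumes u: "interior_point u" and z: "vertex_weights z" and s: "\<And>i. 0 < s $ i"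
    and G: "tail_grid s G" and c: "grid_uniform G c" "prob_space c"
  shows "tnest u z G c = distr (c \<Otimes>\<^sub>M vertex_measure u z) borel (case_prod (tail_subst s))"
proof -
  obtain W where W: "c = mixture G W (uniform_measure lborel)"
    using c by (auto simp: grid_uniform_def)
  have WJ: "W J = emeasure c J" if J: "J \<in> G" for J
  proof -
    have "J \<in> sets borel"
      using tail_gridD(2)[OF G J] by (auto simp: tail_box_def)
    then have "emeasure c J = (\<Sum>J'\<in>G. W J' * emeasure (uniform_measure lborel J') J)"
      unfolding W by (subst emeasure_mixture) auto
    also have "\<dots> = (\<Sum>J'\<in>G. if J' = J then W J else 0)"
      using J emeasure_uniform_tail_box_self(2)[OF tail_gridD(2)[OF G]]
        emeasure_uniform_tail_box_other[OF tail_gridD(2)[OF G] tail_gridD(2)[OF G] tail_gridD(3)[OF G]]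
      by (intro sum.cong refl) (auto simp del: emeasure_uniform_measure)
    finally show ?thesis
      using J tail_gridD(1)[OF G] by simp
  qed
  have "distr (c \<Otimes>\<^sub>M vertex_measure u z) borel (case_prod (tail_subst s)) =
      mixture G W (\<lambda>J. distr (uniform_measure lborel J \<Otimes>\<^sub>M vertex_measure u z) borel (case_prod (tail_subst s)))"
    unfolding W
  proof (rule distr_pair_mixture_left)
    show "prob_space (mixture G W (uniform_measure lborel))"
      using c W by simp
    show "prob_space (vertex_measure u z)"
      using u z by (rule prob_space_vertex_measure)
    show "prob_space (uniform_measure lborel J)" if "J \<in> G" for J
      using tail_gridD(2)[OF G that] by (rule emeasure_uniform_tail_box_self)
  qed auto
  also have "\<dots> = tnest u z G c"
    unfolding tnest_def
    by (rule mixture_cong) (use WJ distr_tail_subst_box[OF u z s] tail_gridD(2)[OF G] in auto)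
  finally show ?thesis ..
qed

lemma distr_affine_uniform_box:
  assumes lh: "\<And>i. l $ i < h $ i" and lh': "\<And>i. l' $ i < h' $ i"
  shows "distr (uniform_box l h) borel (affine_box l' h') = uniform_measure lborel (affine_box l' h' ` cbox l h)"
proof -
  have less: "affine_box l' h' l $ i < affine_box l' h' h $ i" for i
    using lh[of i] lh'[of i] by (simp add: affine_box_def)
  have "affine_box l' h' \<circ> affine_box l h = affine_box (affine_box l' h' l) (affine_box l' h' h)"
    by (auto simp: fun_eq_iff affine_box_def vec_eq_iff algebra_simps)
  then show ?thesis
    unfolding uniform_box_eq_distr[OF lh] image_affine_box[OF lh'] uniform_box_eq_distr[OF less]
    by (subst distr_distr) (auto cong: measurable_cong_sets)
qed

lemma distr_blend_uniform_box:
  fixes l h l' h' :: "real^'n::finite"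
  assumes lh: "\<And>i. l $ i < h $ i" and lh': "\<And>i. l' $ i < h' $ i"
  shows "distr (uniform_box l h \<Otimes>\<^sub>M uniform_box l' h') borel (case_prod (blend S)) =
    uniform_box (blend S l l') (blend S h h')"
proof -
  let ?U = "uniform_cube :: (real^'n) measure"
  interpret U: prob_space ?U by (rule prob_space_uniform_cube)
  have [measurable]: "affine_box l h \<in> borel_measurable ?U" for l h :: "real^'n"
    by (auto cong: measurable_cong_sets)
  have less: "blend S l l' $ i < blend S h h' $ i" for i
    using lh[of i] lh'[of i] by (simp add: blend_def)
  have sf: "sigma_finite_measure (distr ?U borel (affine_box l' h'))"
    by (intro prob_space_imp_sigma_finite U.prob_space_distr) measurable
  have "distr (uniform_box l h \<Otimes>\<^sub>M uniform_box l' h') borel (case_prod (blend S)) =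
      distr (?U \<Otimes>\<^sub>M ?U) borel (case_prod (blend S) \<circ> (\<lambda>(x, y). (affine_box l h x, affine_box l' h' y)))"
    unfolding uniform_box_eq_distr[OF lh] uniform_box_eq_distr[OF lh']
    by (subst pair_measure_distr[OF _ _ sf], measurable) (rule distr_distr; measurable)
  also have "case_prod (blend S) \<circ> (\<lambda>(x, y). (affine_box l h x, affine_box l' h' y)) =
      affine_box (blend S l l') (blend S h h') \<circ> case_prod (blend S)"
    by (auto simp: fun_eq_iff blend_def affine_box_def vec_eq_iff)
  also have "distr (?U \<Otimes>\<^sub>M ?U) borel \<dots> = distr (distr (?U \<Otimes>\<^sub>M ?U) borel (case_prod (blend S))) borel (affine_box (blend S l l') (blend S h h'))"
    by (rule distr_distr[symmetric]; measurable)
  also have "\<dots> = uniform_box (blend S l l') (blend S h h')"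
    unfolding distr_blend_uniform_cube uniform_box_eq_distr[OF less] ..
  finally show ?thesis .
qed

lemma blend_vertex_box:
  "cbox (blend S (vertex_lower u \<mu>) (vertex_lower u \<nu>)) (blend S (vertex_upper u \<mu>) (vertex_upper u \<nu>)) =
    vertex_box u (\<chi> i. if i \<in> S then \<mu> $ i else \<nu> $ i)"
  unfolding vertex_box_eq
  by (rule arg_cong2[of _ _ _ _ cbox]) (auto simp: blend_def vertex_lower_def vertex_upper_def vec_eq_iff)

text \<open>Write the uniform factor as a vertex measure at the same \<open>u\<close>. Blending two
  boxes of this decomposition gives a box of it again, so the result is still uniform on vertex
  boxes.\<close>

lemma partial_copula_mixture:
  fixes u :: "real^'n::finite"
  assumes u: "interior_point u" and z: "vertex_weights z"
  shows "partial_copula u z \<kappa> =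
    mixture UNIV (\<lambda>(\<mu>, \<nu>). ennreal (vertex_volume u \<mu>) * ennreal (z \<nu>))
      (\<lambda>(\<mu>, \<nu>). uniform_measure lborel (vertex_box u (\<chi> i. if \<kappa> $ i then \<mu> $ i else \<nu> $ i)))"
proof -
  let ?f = "case_prod (blend {i. \<kappa> $ i}) :: _ \<Rightarrow> real^'n"
  let ?u = "\<lambda>\<nu>. uniform_measure lborel (vertex_box u \<nu>)"
  have pz: "prob_space (vertex_measure u z)"
    using u z by (rule prob_space_vertex_measure)
  have pv: "prob_space (vertex_measure u (vertex_volume u))"
    using u vertex_weights_volume[OF u] by (rule prob_space_vertex_measure)
  have "partial_copula u z \<kappa> = distr (vertex_measure u (vertex_volume u) \<Otimes>\<^sub>M vertex_measure u z) borel ?f"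
    unfolding partial_copula_eq[OF u z] using uniform_cube_eq_vertex_measure[OF u] by simp
  also have "\<dots> = mixture UNIV (\<lambda>\<mu>. ennreal (vertex_volume u \<mu>)) (\<lambda>\<mu>. distr (?u \<mu> \<Otimes>\<^sub>M vertex_measure u z) borel ?f)"
    using pv[unfolded vertex_measure_def] unfolding vertex_measure_def[of u "vertex_volume u"]
    by (intro distr_pair_mixture_left prob_space_vertex_box pz u) auto
  also have "\<dots> = mixture UNIV (\<lambda>\<mu>. ennreal (vertex_volume u \<mu>)) (\<lambda>\<mu>. mixture UNIV (\<lambda>\<nu>. ennreal (z \<nu>)) (\<lambda>\<nu>. distr (?u \<mu> \<Otimes>\<^sub>M ?u \<nu>) borel ?f))"
    using pz[unfolded vertex_measure_def] unfolding vertex_measure_def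
    by (intro mixture_cong refl distr_pair_mixture_right prob_space_vertex_box u) auto
  also have "\<dots> = mixture (UNIV \<times> UNIV) (\<lambda>(\<mu>, \<nu>). ennreal (vertex_volume u \<mu>) * ennreal (z \<nu>)) (\<lambda>(\<mu>, \<nu>). distr (?u \<mu> \<Otimes>\<^sub>M ?u \<nu>) borel ?f)"
    by (rule mixture_mixture) auto
  also have "\<dots> = mixture UNIV (\<lambda>(\<mu>, \<nu>). ennreal (vertex_volume u \<mu>) * ennreal (z \<nu>))
      (\<lambda>(\<mu>, \<nu>). uniform_measure lborel (vertex_box u (\<chi> i. if \<kappa> $ i then \<mu> $ i else \<nu> $ i)))"
  proof (rule mixture_cong)
    fix p :: "'n vertex \<times> 'n vertex"
    obtain \<mu> \<nu> where p: "p = (\<mu>, \<nu>)" by force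
    have "distr (?u \<mu> \<Otimes>\<^sub>M ?u \<nu>) borel ?f = uniform_measure lborel (vertex_box u (\<chi> i. if i \<in> {i. \<kappa> $ i} then \<mu> $ i else \<nu> $ i))"
      unfolding blend_vertex_box[symmetric] vertex_box_eq[of u \<mu>] vertex_box_eq[of u \<nu>]
      by (intro distr_blend_uniform_box vertex_lower_less_upper u)
    then show "(case p of (\<mu>, \<nu>) \<Rightarrow> distr (?u \<mu> \<Otimes>\<^sub>M ?u \<nu>) borel ?f) =
        (case p of (\<mu>, \<nu>) \<Rightarrow> uniform_measure lborel (vertex_box u (\<chi> i. if \<kappa> $ i then \<mu> $ i else \<nu> $ i)))"
      by (simp add: p)
  qed auto
  finally show ?thesis .
qed

lemma finite_tnest_grid: "finite G \<Longrightarrow> finite (tnest_grid u G)"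
proof -
  have eq: "tnest_grid u G = (\<lambda>(J, \<nu>). grid_map J ` vertex_box u \<nu>) ` (G \<times> UNIV)"
    by (auto simp: tnest_grid_def)
  show "finite G \<Longrightarrow> finite (tnest_grid u G)" unfolding eq by simp
qed

text \<open>Expand each replaced piece by \<open>partial_copula_mixture\<close> and transport it to
  \<open>J\<close>. Distinct labels can give the same box, since each coordinate reads only one of
  the two vertices, hence the final grouping.\<close>

lemma grid_uniform_tnest:
  fixes u :: "real^'n::finite"
  assumes u: "interior_point u" and z: "vertex_weights z" and G: "tail_grid s G"
  shows "grid_uniform (tnest_grid u G) (tnest u z G c)"
proof -
  \<comment> \<open>The box reached from \<open>J\<close> when the uniform factor falls into the box
    of \<open>\<mu>\<close> and the vertex sample into that of \<open>\<nu>\<close>.\<close>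
  define K where "K = (\<lambda>(J, \<mu> :: 'n vertex, \<nu> :: 'n vertex).
    grid_map J ` vertex_box u (\<chi> i. if grid_vertex J $ i then \<mu> $ i else \<nu> $ i))"
  let ?w = "\<lambda>(\<mu>, \<nu>). ennreal (vertex_volume u \<mu>) * ennreal (z \<nu>)"
  have "distr (partial_copula u z (grid_vertex J)) borel (grid_map J) =
      mixture UNIV ?w (\<lambda>p. uniform_measure lborel (K (J, p)))" if J: "J \<in> G" for J
  proof -
    obtain l h where Jlh: "J = cbox l h" and lh: "\<And>i. l $ i < h $ i"
      using tail_gridD(2)[OF G J] by (rule tail_boxE) blast
    show ?thesis
      unfolding partial_copula_mixture[OF u z]
    proof (subst distr_mixture, goal_cases)
      case 3
      show ?case
      proof (rule mixture_cong)
        fix p :: "'n vertex \<times> 'n vertex"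
        obtain \<mu> \<nu> where p: "p = (\<mu>, \<nu>)" by force
        show "distr (case p of (\<mu>, \<nu>) \<Rightarrow> uniform_measure lborel (vertex_box u (\<chi> i. if grid_vertex J $ i then \<mu> $ i else \<nu> $ i)))
            borel (grid_map J) = uniform_measure lborel (K (J, p))"
          unfolding p prod.case K_def vertex_box_eq Jlh grid_map_cbox[OF lh]
          by (intro distr_affine_uniform_box vertex_lower_less_upper u lh)
      qed auto
    qed (auto simp: Jlh grid_map_cbox[OF lh])
  qed
  then have "tnest u z G c = mixture G (emeasure c) (\<lambda>J. mixture UNIV ?w (\<lambda>p. uniform_measure lborel (K (J, p))))"
    unfolding tnest_def by (intro mixture_cong) auto
  also have "\<dots> = mixture (G \<times> UNIV) (\<lambda>(J, p). emeasure c J * ?w p) (\<lambda>(J, p). uniform_measure lborel (K (J, p)))"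
    by (rule mixture_mixture) auto
  also have "\<dots> = mixture (G \<times> UNIV) (\<lambda>(J, p). emeasure c J * ?w p) (\<lambda>x. uniform_measure lborel (K x))"
    by (rule mixture_cong) auto
  also have "\<dots> = mixture (tnest_grid u G)
      (\<lambda>J. \<Sum>x | x \<in> G \<times> UNIV \<and> K x = J. case x of (J, p) \<Rightarrow> emeasure c J * ?w p) (uniform_measure lborel)"
    by (rule mixture_group)
      (use tail_gridD(1)[OF G] finite_tnest_grid in \<open>auto simp: K_def tnest_grid_def\<close>)
  finally show ?thesis
    by (rule grid_uniformI)
qed

lemma interior_cbox_disjoint:
  fixes l h l' h' :: "real^'n::finite"
  assumes "h $ i \<le> l' $ i"
  shows "interior (cbox l h) \<inter> interior (cbox l' h') = {}"
proof -
  have False if "x \<in> box l h" "x \<in> box l' h'" for x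
  proof -
    have "x $ i < h $ i" "l' $ i < x $ i"
      using that by (auto simp: mem_box_cart)
    with assms show False by simp
  qed
  then show ?thesis by auto
qed

text \<open>A first interval ending at \<open>s $ i\<close> is cut at \<open>s $ i * u $ i\<close>,
  the new scale; the pieces of all other intervals start beyond the old scale. Distinct pieces of
  one box are separated by a cutting hyperplane, and pieces of distinct boxes inherit disjointness
  from these.\<close>

lemma tail_grid_tnest_grid:
  assumes u: "interior_point u" and s: "\<And>i. 0 < s $ i" and G: "tail_grid s G"
  shows "tail_grid (\<chi> i. s $ i * u $ i) (tnest_grid u G)"
proof -
  have box: "tail_box (\<chi> i. s $ i * u $ i) (grid_map J ` vertex_box u \<nu>)" if J: "J \<in> G" for J \<nu>
  proof -
    obtain l h where Jlh: "J = cbox l h" and lh: "\<And>i. l $ i < h $ i"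
      and tail: "\<And>i. l $ i = 0 \<and> h $ i = s $ i \<or> s $ i \<le> l $ i"
      using tail_gridD(2)[OF G J] by (rule tail_boxE) blast
    have "affine_box l h (vertex_lower u \<nu>) $ i < affine_box l h (vertex_upper u \<nu>) $ i" for i
      using vertex_lower_less_upper[OF u, of \<nu> i] lh[of i] by (simp add: affine_box_def)
    moreover have "affine_box l h (vertex_lower u \<nu>) $ i = 0 \<and>
        affine_box l h (vertex_upper u \<nu>) $ i = s $ i * u $ i \<or>
        s $ i * u $ i \<le> affine_box l h (vertex_lower u \<nu>) $ i" for i
    proof (cases "l $ i = 0 \<and> h $ i = s $ i")
      case True
      then show ?thesis
        by (simp add: affine_box_def vertex_lower_def vertex_upper_def)
    next
      case False
      then have "s $ i \<le> l $ i" using tail[of i] by auto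
      moreover have "s $ i * u $ i \<le> s $ i"
        using u s[of i] by (auto simp: interior_point_def mult_left_le less_imp_le)
      moreover have "0 \<le> vertex_lower u \<nu> $ i * (h $ i - l $ i)"
        using vertex_lower_nonneg[OF u] lh[of i] by simp
      ultimately show ?thesis
        by (simp add: affine_box_def)
    qed
    ultimately show ?thesis
      unfolding tail_box_def Jlh grid_map_cbox[OF lh] vertex_box_eq image_affine_box[OF lh] by force
  qed
  have disj: "interior (grid_map J ` vertex_box u \<nu>) \<inter> interior (grid_map J' ` vertex_box u \<nu>') = {}"
    if J: "J \<in> G" "J' \<in> G" and ne: "J \<noteq> J' \<or> \<nu> \<noteq> \<nu>'" for J J' \<nu> \<nu>'
  proof (cases "J = J'")
    case True
    obtain l h where Jlh: "J = cbox l h" and lh: "\<And>i. l $ i < h $ i"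
      using tail_gridD(2)[OF G J(1)] by (rule tail_boxE) blast
    have *: "interior (grid_map J ` vertex_box u \<nu>) \<inter> interior (grid_map J ` vertex_box u \<nu>') = {}"
      if "\<not> \<nu> $ i" "\<nu>' $ i" for \<nu> \<nu>' i
      unfolding Jlh grid_map_cbox[OF lh] vertex_box_eq image_affine_box[OF lh]
      by (rule interior_cbox_disjoint[of _ i]) (use that in \<open>simp add: affine_box_def vertex_lower_def vertex_upper_def\<close>)
    obtain i where "\<nu> $ i \<noteq> \<nu>' $ i"
      using ne True by (auto simp: vec_eq_iff)
    then show ?thesis
      using *[of \<nu> i \<nu>'] *[of \<nu>' i \<nu>] True by auto
  next
    case False
    have sub: "grid_map J ` vertex_box u \<nu> \<subseteq> J" if J: "J \<in> G" for J \<nu>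
    proof -
      obtain l h where Jlh: "J = cbox l h" and lh: "\<And>i. l $ i < h $ i"
        using tail_gridD(2)[OF G J] by (rule tail_boxE) blast
      have "vertex_box u \<nu> \<subseteq> cbox 0 1"
      proof
        fix x assume "x \<in> vertex_box u \<nu>"
        then have "vertex_lower u \<nu> $ i \<le> x $ i \<and> x $ i \<le> vertex_upper u \<nu> $ i" for i
          unfolding vertex_box_eq mem_box_cart by blast
        then have "0 \<le> x $ i \<and> x $ i \<le> 1" for i
          using vertex_lower_nonneg[OF u, of \<nu> i] vertex_upper_le_1[OF u, of \<nu> i]
          by (meson order_trans)
        then show "x \<in> cbox 0 1"
          by (simp add: mem_box_cart)
      qed
      then have "grid_map J ` vertex_box u \<nu> \<subseteq> affine_box l h ` cbox 0 1"
        unfolding Jlh grid_map_cbox[OF lh] by (rule image_mono)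
      also have "\<dots> = J"
        unfolding image_affine_box[OF lh] Jlh
        by (rule arg_cong2[of _ _ _ _ cbox]) (auto simp: affine_box_def vec_eq_iff)
      finally show ?thesis .
    qed
    show ?thesis
      using tail_gridD(3)[OF G J False] interior_mono[OF sub[OF J(1), of \<nu>]]
        interior_mono[OF sub[OF J(2), of \<nu>']] by auto
  qed
  show ?thesis
    unfolding tail_grid_def
  proof (intro conjI ballI impI)
    fix K K' assume K: "K \<in> tnest_grid u G" "K' \<in> tnest_grid u G" and ne: "K \<noteq> K'"
    obtain J \<nu> where J: "J \<in> G" "K = grid_map J ` vertex_box u \<nu>"
      using K(1) unfolding tnest_grid_def by blast
    obtain J' \<nu>' where J': "J' \<in> G" "K' = grid_map J' ` vertex_box u \<nu>'"
      using K(2) unfolding tnest_grid_def by blast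
    have "J \<noteq> J' \<or> \<nu> \<noteq> \<nu>'"
      using ne unfolding J J' by blast
    from disj[OF J(1) J'(1) this] show "interior K \<inter> interior K' = {}"
      unfolding J J' .
  qed (use finite_tnest_grid[OF tail_gridD(1)[OF G]] box in \<open>auto simp: tnest_grid_def\<close>)
qed

lemma tail_grid_vertex_grid:
  assumes u: "interior_point u"
  shows "tail_grid u (vertex_grid u)"
proof -
  have "tail_box u (vertex_box u \<nu>)" for \<nu>
    unfolding tail_box_def vertex_box_eq
    using vertex_lower_less_upper[OF u]
    by (intro exI conjI allI refl) (auto simp: vertex_lower_def vertex_upper_def split: if_splits)
  moreover have disj: "interior (vertex_box u \<nu>) \<inter> interior (vertex_box u \<nu>') = {}" if ne: "\<nu> \<noteq> \<nu>'" for \<nu> \<nu>'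
  proof -
    have *: "interior (vertex_box u \<nu>) \<inter> interior (vertex_box u \<nu>') = {}" if "\<not> \<nu> $ i" "\<nu>' $ i" for \<nu> \<nu>' i
      unfolding vertex_box_eq
      by (rule interior_cbox_disjoint[of _ i]) (use that in \<open>simp add: vertex_lower_def vertex_upper_def\<close>)
    obtain i where "\<nu> $ i \<noteq> \<nu>' $ i"
      using ne by (auto simp: vec_eq_iff)
    then show ?thesis
      using *[of \<nu> i \<nu>'] *[of \<nu>' i \<nu>] by auto
  qed
  ultimately show ?thesis
    unfolding tail_grid_def vertex_grid_def
  proof (intro conjI ballI impI)
    fix J J' assume "J \<in> range (vertex_box u)" "J' \<in> range (vertex_box u)" "J \<noteq> J'"
    then show "interior J \<inter> interior J' = {}"
      using disj by (metis imageE)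
  qed auto
qed

lemma grid_uniform_vertex_measure: "grid_uniform (vertex_grid u) (vertex_measure u z)"
  unfolding grid_uniform_def vertex_measure_def vertex_grid_def
  by (intro exI, rule mixture_group) auto

lemma AE_vertex_measure:
  fixes u :: "real^'n::finite"
  assumes u: "interior_point u"
  shows "AE x in vertex_measure u z. x \<in> cbox 0 1 \<and> (\<forall>i. x $ i \<noteq> u $ i)"
proof -
  let ?P = "\<lambda>x :: real^'n. x \<in> cbox 0 1 \<and> (\<forall>i. x $ i \<noteq> u $ i)"
  have [measurable]: "{x. \<not> ?P x} \<in> sets borel" by measurable
  have "emeasure (uniform_measure lborel (vertex_box u \<nu>)) {x. \<not> ?P x} = 0" for \<nu>
  proof -
    have "AE x in uniform_measure lborel (vertex_box u \<nu>). ?P x"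
      unfolding vertex_box_eq using AE_uniform_box
    proof eventually_elim
      case (elim x)
      have "0 \<le> x $ i \<and> x $ i \<le> 1 \<and> x $ i \<noteq> u $ i" for i
      proof -
        have "vertex_lower u \<nu> $ i < x $ i \<and> x $ i < vertex_upper u \<nu> $ i"
          using elim by (auto simp: mem_box_cart)
        then show ?thesis
          using u[unfolded interior_point_def, rule_format, of i]
          by (auto simp: vertex_lower_def vertex_upper_def split: if_splits)
      qed
      then show ?case
        by (simp add: mem_box_cart)
    qed
    from emeasure_eq_0_AE[of "\<lambda>x. \<not> ?P x" "uniform_measure lborel (vertex_box u \<nu>)"] this show ?thesis
      by (simp del: emeasure_uniform_measure)
  qed
  then have "emeasure (vertex_measure u z) {x. \<not> ?P x} = 0"
    by (simp add: emeasure_vertex_measure del: emeasure_uniform_measure)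
  then show ?thesis
    by (subst AE_iff_measurable[of "{x. \<not> ?P x}"]) auto
qed

text \<open>Vertices are recorded by their zeros, the coordinates in which the box of the vertex
  lies on the tail side of \<open>u\<close>; this matches the index sets of
  \<open>moebius\<close>.\<close>

definition zero_set :: "('n::finite) vertex \<Rightarrow> 'n set" where
  "zero_set \<nu> = {i. \<not> \<nu> $ i}"

text \<open>Off the boundary of its box a point is below \<open>u\<close> exactly in the coordinates
  of \<open>zero_set \<nu>\<close>, so each box counts fully or not at all.\<close>

lemma emeasure_vertex_measure_lower:
  fixes u :: "real^'n::finite"
  assumes u: "interior_point u" and z: "vertex_weights z"
  shows "emeasure (vertex_measure u z) {x. \<forall>i\<in>F. x $ i < u $ i} = ennreal (\<Sum>\<nu> | F \<subseteq> zero_set \<nu>. z \<nu>)"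
proof -
  let ?A = "{x. \<forall>i\<in>F. x $ i < u $ i}"
  have A: "?A \<in> sets borel" by measurable
  have "emeasure (uniform_measure lborel (vertex_box u \<nu>)) ?A = (if F \<subseteq> zero_set \<nu> then 1 else 0)" for \<nu>
  proof -
    interpret P: prob_space "uniform_measure lborel (vertex_box u \<nu>)"
      using u by (rule prob_space_vertex_box)
    have bounds: "AE x in uniform_measure lborel (vertex_box u \<nu>). \<forall>i. vertex_lower u \<nu> $ i < x $ i \<and> x $ i < vertex_upper u \<nu> $ i"
      unfolding vertex_box_eq using AE_uniform_box by eventually_elim (auto simp: mem_box_cart)
    show ?thesis
    proof (cases "F \<subseteq> zero_set \<nu>")
      case True
      have "AE x in uniform_measure lborel (vertex_box u \<nu>). x \<in> ?A"
        using bounds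
      proof eventually_elim
        case (elim x)
        have "x $ i < u $ i" if "i \<in> F" for i
          using elim[rule_format, of i] that True by (auto simp: vertex_upper_def zero_set_def)
        then show ?case by simp
      qed
      with P.emeasure_eq_1_AE[of ?A] A True show ?thesis
        by simp
    next
      case False
      then obtain i where i: "i \<in> F" "\<nu> $ i" by (auto simp: zero_set_def)
      have "AE x in uniform_measure lborel (vertex_box u \<nu>). \<not> (\<forall>i\<in>F. x $ i < u $ i)"
        using bounds
      proof eventually_elim
        case (elim x)
        from elim[rule_format, of i] i show ?case
          by (auto simp: vertex_lower_def intro!: bexI[of _ i])
      qed
      with emeasure_eq_0_AE[of "\<lambda>x. \<forall>i\<in>F. x $ i < u $ i" "uniform_measure lborel (vertex_box u \<nu>)"] False show ?thesis
        by (simp del: emeasure_uniform_measure)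
    qed
  qed
  then have "emeasure (vertex_measure u z) ?A = (\<Sum>\<nu>\<in>UNIV. ennreal (if F \<subseteq> zero_set \<nu> then z \<nu> else 0))"
    unfolding emeasure_vertex_measure[OF A] by (intro sum.cong) auto
  also have "\<dots> = ennreal (\<Sum>\<nu>\<in>UNIV. if F \<subseteq> zero_set \<nu> then z \<nu> else 0)"
    using z by (intro sum_ennreal) (auto simp: vertex_weights_def)
  finally show ?thesis
    by (simp flip: sum.inter_filter)
qed

section \<open>The random substitution process realising the iterated nested copulas\<close>

locale tail_nesting =
  fixes u :: "nat \<Rightarrow> real^'n::finite" and z :: "nat \<Rightarrow> 'n vertex \<Rightarrow> real"
  assumes u: "\<And>n. interior_point (u n)" and z: "\<And>n. vertex_weights (z n)"
begin

text \<open>The upper corner of the grid box at the origin after step \<open>n\<close>.\<close>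

definition scale :: "nat \<Rightarrow> real^'n" where
  "scale n = (\<chi> i. \<Prod>j\<le>n. u j $ i)"

abbreviation V :: "nat \<Rightarrow> (real^'n) measure" where
  "V n \<equiv> vertex_measure (u n) (z n)"

abbreviation \<Omega> :: "(nat \<Rightarrow> real^'n) measure" where
  "\<Omega> \<equiv> PiM UNIV V"

primrec X :: "nat \<Rightarrow> (nat \<Rightarrow> real^'n) \<Rightarrow> real^'n" where
  "X 0 \<omega> = \<omega> 0"
| "X (Suc n) \<omega> = tail_subst (scale n) (X n \<omega>) (\<omega> (Suc n))"

text \<open>A total definition that is measurable at once; once the scales tend to 0, it is the true
  limit at every \<open>regular\<close> point.\<close>

definition X_lim :: "(nat \<Rightarrow> real^'n) \<Rightarrow> real^'n" where
  "X_lim \<omega> = lim (\<lambda>n. X n \<omega>)"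

lemma u_bounds: "0 < u n $ i" "u n $ i < 1"
  using u[of n] by (auto simp: interior_point_def)

lemma scale_0: "scale 0 = u 0"
  by (simp add: scale_def vec_eq_iff)

lemma scale_Suc: "scale (Suc n) = (\<chi> i. scale n $ i * u (Suc n) $ i)"
  by (simp add: scale_def vec_eq_iff)

lemma scale_pos: "0 < scale n $ i"
  by (auto simp: scale_def u_bounds intro!: prod_pos)

lemma scale_Suc_less: "scale (Suc n) $ i < scale n $ i"
  using scale_pos[of n i] u_bounds[of "Suc n" i] by (simp add: scale_Suc)

lemma scale_antimono: "m \<le> n \<Longrightarrow> scale n $ i \<le> scale m $ i"
  by (rule lift_Suc_antimono_le[of "\<lambda>n. scale n $ i"]) (use scale_Suc_less less_imp_le in auto)

lemma prob_space_V: "prob_space (V n)"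
  using u z by (rule prob_space_vertex_measure)

lemma prob_space_\<Omega>: "prob_space \<Omega>"
  by (intro prob_space_PiM prob_space_V)

text \<open>The index set is left general because \<open>joint_law\<close> needs \<open>X n\<close>
  as a function of the samples up to \<open>n\<close> alone.\<close>

lemma measurable_X_PiM:
  assumes "{..n} \<subseteq> I"
  shows "X n \<in> borel_measurable (PiM I V)"
  using assms
proof (induction n)
  case 0
  have "(\<lambda>\<omega>. \<omega> 0) \<in> measurable (PiM I V) (V 0)"
    using 0 by (intro measurable_component_singleton) auto
  then show ?case
    by (simp cong: measurable_cong_sets)
next
  case (Suc n)
  have "(\<lambda>\<omega>. \<omega> (Suc n)) \<in> measurable (PiM I V) (V (Suc n))"
    using Suc.prems by (intro measurable_component_singleton) auto
  then have [measurable]: "(\<lambda>\<omega>. \<omega> (Suc n)) \<in> borel_measurable (PiM I V)"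
    by (simp cong: measurable_cong_sets)
  have [measurable]: "X n \<in> borel_measurable (PiM I V)"
    using Suc.prems by (intro Suc.IH) (auto simp: atMost_Suc)
  show ?case
    unfolding X.simps tail_subst_def by measurable
qed

lemma measurable_X [measurable]: "X n \<in> borel_measurable \<Omega>"
  by (rule measurable_X_PiM) simp

lemma measurable_X_lim [measurable]: "X_lim \<in> borel_measurable \<Omega>"
  unfolding X_lim_def by measurable

lemma X_restrict: "{..n} \<subseteq> A \<Longrightarrow> X n (restrict \<omega> A) = X n \<omega>"
  by (induction n) (auto simp: atMost_Suc)

declare X.simps(2) [simp del]

lemma X_Suc_eq: "X (Suc n) = (\<lambda>\<omega>. tail_subst (scale n) (X n \<omega>) (\<omega> (Suc n)))"
  by (simp add: fun_eq_iff X.simps(2))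

text \<open>\<open>X n\<close> depends only on the samples up to \<open>n\<close> and is therefore
  independent of the next one. This provides the product measure that occurs in
  \<open>tnest_eq_distr\<close>.\<close>

lemma joint_law:
  "distr \<Omega> (borel \<Otimes>\<^sub>M borel) (\<lambda>\<omega>. (X n \<omega>, \<omega> (Suc n))) = distr \<Omega> borel (X n) \<Otimes>\<^sub>M V (Suc n)"
proof -
  interpret prob_space \<Omega> by (rule prob_space_\<Omega>)
  have comp: "distr \<Omega> (V i) (\<lambda>\<omega>. \<omega> i) = V i" for i
    by (rule distr_PiM_component) (auto simp: prob_space_V)
  have ind: "indep_vars V (\<lambda>i \<omega>. \<omega> i) UNIV"
    by (subst indep_vars_iff_distr_eq_PiM') (auto simp: comp distr_id2 restrict_UNIV)
  have "indep_var (PiM {..n} V) (\<lambda>\<omega>. restrict (\<lambda>i. \<omega> i) {..n}) (PiM {Suc n} V) (\<lambda>\<omega>. restrict (\<lambda>i. \<omega> i) {Suc n})"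
    by (rule indep_var_restrict[OF ind]) auto
  then have "indep_var borel (X n \<circ> (\<lambda>\<omega>. restrict (\<lambda>i. \<omega> i) {..n}))
      (V (Suc n)) ((\<lambda>\<omega>. \<omega> (Suc n)) \<circ> (\<lambda>\<omega>. restrict (\<lambda>i. \<omega> i) {Suc n}))"
    by (rule indep_var_compose) (auto intro: measurable_X_PiM measurable_component_singleton)
  then have "indep_var borel (X n) (V (Suc n)) (\<lambda>\<omega>. \<omega> (Suc n))"
    by (simp add: comp_def X_restrict)
  then have "distr \<Omega> borel (X n) \<Otimes>\<^sub>M distr \<Omega> (V (Suc n)) (\<lambda>\<omega>. \<omega> (Suc n)) =
      distr \<Omega> (borel \<Otimes>\<^sub>M V (Suc n)) (\<lambda>\<omega>. (X n \<omega>, \<omega> (Suc n)))"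
    unfolding indep_var_distribution_eq by blast
  also have "\<dots> = distr \<Omega> (borel \<Otimes>\<^sub>M borel) (\<lambda>\<omega>. (X n \<omega>, \<omega> (Suc n)))"
    by (rule distr_cong) (auto intro: sets_pair_measure_cong)
  finally show ?thesis
    by (simp add: comp)
qed

text \<open>The grid invariants are proved together with the law, as each nesting step can be read
  as a substitution only under them.\<close>

lemma tnest_iter_law:
  "tail_grid (scale n) (fst (tnest_iter u z n)) \<and>
   grid_uniform (fst (tnest_iter u z n)) (snd (tnest_iter u z n)) \<and>
   snd (tnest_iter u z n) = distr \<Omega> borel (X n)"
proof (induction n)
  case 0
  have "distr \<Omega> borel (\<lambda>\<omega>. \<omega> 0) = distr \<Omega> (V 0) (\<lambda>\<omega>. \<omega> 0)"
    by (rule distr_cong) auto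
  also have "\<dots> = V 0"
    by (rule distr_PiM_component) (auto simp: prob_space_V)
  finally show ?case
    using tail_grid_vertex_grid[OF u, of 0] grid_uniform_vertex_measure[of "u 0" "z 0"]
    by (simp add: scale_0)
next
  case (Suc n)
  interpret P: prob_space \<Omega> by (rule prob_space_\<Omega>)
  let ?G = "fst (tnest_iter u z n)" and ?c = "snd (tnest_iter u z n)"
  have c: "?c = distr \<Omega> borel (X n)" and G: "tail_grid (scale n) ?G" and gu: "grid_uniform ?G ?c"
    using Suc by auto
  have pc: "prob_space ?c"
    unfolding c by (rule P.prob_space_distr) measurable
  have [measurable]: "(\<lambda>\<omega>. \<omega> (Suc n)) \<in> borel_measurable \<Omega>"
    using measurable_component_singleton[of "Suc n" UNIV V] by (simp cong: measurable_cong_sets)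
  have "tnest (u (Suc n)) (z (Suc n)) ?G ?c = distr (?c \<Otimes>\<^sub>M V (Suc n)) borel (case_prod (tail_subst (scale n)))"
    by (rule tnest_eq_distr[OF u z scale_pos G gu pc])
  also have "\<dots> = distr (distr \<Omega> (borel \<Otimes>\<^sub>M borel) (\<lambda>\<omega>. (X n \<omega>, \<omega> (Suc n)))) borel (case_prod (tail_subst (scale n)))"
    unfolding c joint_law ..
  also have "\<dots> = distr \<Omega> borel (X (Suc n))"
    by (subst distr_distr) (auto simp: comp_def X_Suc_eq)
  finally show ?case
    using tail_grid_tnest_grid[OF u scale_pos G, of "Suc n"]
      grid_uniform_tnest[OF u z G, of "Suc n" "Suc n" ?c]
    by (simp add: scale_Suc)
qed

text \<open>The event of full measure on which all path arguments are carried out; excluding ties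
  with \<open>u\<close> turns weak into strict inequalities.\<close>

definition regular :: "(nat \<Rightarrow> real^'n) \<Rightarrow> bool" where
  "regular \<omega> \<longleftrightarrow> (\<forall>j. \<omega> j \<in> cbox 0 1 \<and> (\<forall>i. \<omega> j $ i \<noteq> u j $ i))"

lemma AE_regular: "AE \<omega> in \<Omega>. regular \<omega>"
  unfolding regular_def AE_all_countable
  by (intro allI AE_PiM_component[of UNIV V, OF _ UNIV_I AE_vertex_measure[OF u]] prob_space_V)

lemma regularD:
  assumes "regular \<omega>"
  shows "0 \<le> \<omega> j $ i" "\<omega> j $ i \<le> 1" "\<omega> j $ i \<noteq> u j $ i"
  using assms by (auto simp: regular_def mem_box_cart)

lemma X_Suc: "X (Suc n) \<omega> $ i = (if X n \<omega> $ i < scale n $ i then scale n $ i * \<omega> (Suc n) $ i else X n \<omega> $ i)"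
  by (simp add: X_Suc_eq tail_subst_def)

lemma X_nonneg: "regular \<omega> \<Longrightarrow> 0 \<le> X n \<omega> $ i"
  by (induction n) (auto simp: X_Suc regularD less_imp_le[OF scale_pos])

text \<open>While a coordinate is below the scale it equals the previous scale times the fresh
  sample, so it passes the next scale exactly if the sample is below \<open>u\<close>. Once it is
  not, the decreasing scales leave it strictly above.\<close>

lemma X_less_scale:
  assumes "regular \<omega>"
  shows "(X n \<omega> $ i < scale n $ i \<longleftrightarrow> (\<forall>j\<le>n. \<omega> j $ i < u j $ i)) \<and> X n \<omega> $ i \<noteq> scale n $ i"
proof (induction n)
  case 0
  then show ?case
    using regularD[OF assms] by (simp add: scale_0)
next
  case (Suc n)
  show ?case
  proof (cases "X n \<omega> $ i < scale n $ i")
    case True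
    then have "X (Suc n) \<omega> $ i = scale n $ i * \<omega> (Suc n) $ i"
      by (simp add: X_Suc)
    moreover have "\<forall>j\<le>n. \<omega> j $ i < u j $ i"
      using True Suc by auto
    ultimately show ?thesis
      using scale_pos[of n i] regularD(3)[OF assms, of "Suc n" i] by (auto simp: scale_Suc le_Suc_eq)
  next
    case False
    then have "X (Suc n) \<omega> $ i > scale (Suc n) $ i"
      using scale_Suc_less[of n i] by (simp add: X_Suc)
    moreover have "\<not> (\<forall>j\<le>n. \<omega> j $ i < u j $ i)"
      using False Suc by auto
    ultimately show ?thesis
      by (auto dest: le_SucI)
  qed
qed

lemma X_frozen:
  assumes "scale n $ i \<le> X n \<omega> $ i" "n \<le> m"
  shows "X m \<omega> $ i = X n \<omega> $ i"
  using assms(2)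
proof (induction m rule: dec_induct)
  case (step m)
  then have "scale m $ i \<le> X m \<omega> $ i"
    using assms(1) scale_antimono[of n m i] by simp
  then show ?case
    using step by (simp add: X_Suc)
qed simp

lemma X_le_scale:
  assumes "regular \<omega>" "X n \<omega> $ i \<le> scale n $ i" "n \<le> m"
  shows "X m \<omega> $ i \<le> scale n $ i"
  using assms(3)
proof (induction m rule: dec_induct)
  case (step m)
  have "scale m $ i * \<omega> (Suc m) $ i \<le> scale m $ i"
    using scale_pos[of m i] regularD[OF assms(1), of "Suc m" i] by (simp add: mult_left_le)
  then show ?case
    using step scale_antimono[of n m i] by (simp add: X_Suc)
qed (use assms in simp)

section \<open>The pointwise limit and its tail masses\<close>

context
  assumes scale_tendsto_0: "\<And>i. (\<lambda>n. scale n $ i) \<longlonglongrightarrow> 0"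
begin

text \<open>A coordinate either reaches its scale at some step and is frozen from then on, or stays
  between 0 and scales that tend to 0.\<close>

lemma X_tendsto_X_lim:
  assumes "regular \<omega>"
  shows "(\<lambda>n. X n \<omega>) \<longlonglongrightarrow> X_lim \<omega>"
proof -
  have "\<exists>l. (\<lambda>n. X n \<omega> $ i) \<longlonglongrightarrow> l" for i
  proof (cases "\<exists>n. scale n $ i \<le> X n \<omega> $ i")
    case True
    then obtain n where "scale n $ i \<le> X n \<omega> $ i" ..
    then have "\<forall>\<^sub>F m in sequentially. X m \<omega> $ i = X n \<omega> $ i"
      by (intro eventually_sequentiallyI X_frozen)
    then show ?thesis
      by (intro exI) (rule tendsto_eventually)
  next
    case False
    have "(\<lambda>n. X n \<omega> $ i) \<longlonglongrightarrow> 0"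
      by (rule tendsto_sandwich[OF _ _ tendsto_const scale_tendsto_0[of i]])
        (use False X_nonneg[OF assms] in \<open>auto simp: not_le less_imp_le\<close>)
    then show ?thesis ..
  qed
  then obtain l where "\<And>i. (\<lambda>n. X n \<omega> $ i) \<longlonglongrightarrow> l i" by metis
  then have "(\<lambda>n. X n \<omega>) \<longlonglongrightarrow> (\<chi> i. l i)"
    by (intro vec_tendstoI) simp
  then show ?thesis
    unfolding X_lim_def by (simp add: limI)
qed

text \<open>If \<open>X n\<close> is below the scale in coordinate \<open>i\<close>, it remains
  trapped there and so does its limit. Otherwise regularity makes it strictly larger, and it is
  frozen at that value.\<close>

lemma X_lim_le_scale:
  assumes "regular \<omega>"
  shows "X_lim \<omega> $ i \<le> scale n $ i \<longleftrightarrow> (\<forall>j\<le>n. \<omega> j $ i < u j $ i)" and "0 \<le> X_lim \<omega> $ i"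
proof -
  have lim: "(\<lambda>n. X n \<omega> $ i) \<longlonglongrightarrow> X_lim \<omega> $ i"
    by (intro tendsto_vec_nth X_tendsto_X_lim assms)
  then show "0 \<le> X_lim \<omega> $ i"
    by (rule LIMSEQ_le_const) (use X_nonneg[OF assms] in auto)
  show "X_lim \<omega> $ i \<le> scale n $ i \<longleftrightarrow> (\<forall>j\<le>n. \<omega> j $ i < u j $ i)"
  proof (cases "X n \<omega> $ i < scale n $ i")
    case True
    then have "X_lim \<omega> $ i \<le> scale n $ i"
      by (intro LIMSEQ_le_const2[OF lim] exI[of _ n]) (use X_le_scale[OF assms] in auto)
    then show ?thesis
      using True X_less_scale[OF assms] by blast
  next
    case False
    then have gt: "scale n $ i < X n \<omega> $ i"
      using X_less_scale[OF assms, of n i] by auto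
    then have "\<forall>\<^sub>F m in sequentially. X m \<omega> $ i = X n \<omega> $ i"
      by (intro eventually_sequentiallyI[of n] X_frozen) auto
    then have "X_lim \<omega> $ i = X n \<omega> $ i"
      by (intro LIMSEQ_unique[OF lim] tendsto_eventually)
    then show ?thesis
      using False gt X_less_scale[OF assms, of n i] by auto
  qed
qed

definition limit_law :: "(real^'n) measure" where
  "limit_law = distr \<Omega> borel X_lim"

text \<open>Pointwise convergence on one probability space yields weak convergence by dominated
  convergence.\<close>

lemma is_tnest_limit_limit_law: "is_tnest_limit u z limit_law"
proof -
  interpret P: prob_space \<Omega> by (rule prob_space_\<Omega>)
  have "(\<lambda>n. integral\<^sup>L (snd (tnest_iter u z n)) f) \<longlonglongrightarrow> integral\<^sup>L limit_law f"
    if f: "continuous_on UNIV f" "bounded (range f)" for f :: "real^'n \<Rightarrow> real"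
  proof -
    have [measurable]: "f \<in> borel_measurable borel"
      using f(1) by (rule borel_measurable_continuous_onI)
    obtain B where B: "\<And>x. norm (f x) \<le> B"
      using f(2) by (auto simp: bounded_iff)
    have "(\<lambda>n. \<integral>\<omega>. f (X n \<omega>) \<partial>\<Omega>) \<longlonglongrightarrow> (\<integral>\<omega>. f (X_lim \<omega>) \<partial>\<Omega>)"
    proof (rule integral_dominated_convergence[where w="\<lambda>_. B"])
      show "AE \<omega> in \<Omega>. (\<lambda>n. f (X n \<omega>)) \<longlonglongrightarrow> f (X_lim \<omega>)"
        using AE_regular
      proof eventually_elim
        case (elim \<omega>)
        show ?case
          using f(1) by (intro isCont_tendsto_compose[OF _ X_tendsto_X_lim[OF elim]])
            (auto simp: continuous_on_eq_continuous_at)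
      qed
    qed (use B in auto)
    then show ?thesis
      using tnest_iter_law by (simp add: limit_law_def integral_distr)
  qed
  then show ?thesis
    unfolding is_tnest_limit_def weak_limit_def
    by (auto simp: limit_law_def intro: P.prob_space_distr)
qed

text \<open>Almost surely the tail event is the cylinder in which the samples up to \<open>n\<close>
  are below their division points in all coordinates of \<open>F\<close>. The product measure then
  factorises: this is the multiplicativity of the tails.\<close>

lemma limit_law_tail:
  "emeasure limit_law {x. \<forall>i\<in>F. 0 \<le> x $ i \<and> x $ i \<le> scale n $ i} =
    ennreal (\<Prod>j\<le>n. \<Sum>\<nu> | F \<subseteq> zero_set \<nu>. z j \<nu>)"
proof -
  let ?A = "\<lambda>j. {x. \<forall>i\<in>F. x $ i < u j $ i}"
  let ?E = "prod_emb UNIV V {..n} (Pi\<^sub>E {..n} ?A)"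
  have A: "?A j \<in> sets borel" for j by measurable
  have [measurable]: "{x. \<forall>i\<in>F. 0 \<le> x $ i \<and> x $ i \<le> scale n $ i} \<in> sets borel"
    by measurable
  have "emeasure limit_law {x. \<forall>i\<in>F. 0 \<le> x $ i \<and> x $ i \<le> scale n $ i} =
      emeasure \<Omega> (X_lim -` {x. \<forall>i\<in>F. 0 \<le> x $ i \<and> x $ i \<le> scale n $ i} \<inter> space \<Omega>)"
    unfolding limit_law_def by (rule emeasure_distr) measurable
  also have "\<dots> = emeasure \<Omega> ?E"
  proof (rule emeasure_eq_AE)
    show "AE \<omega> in \<Omega>. (\<omega> \<in> X_lim -` {x. \<forall>i\<in>F. 0 \<le> x $ i \<and> x $ i \<le> scale n $ i} \<inter> space \<Omega>) = (\<omega> \<in> ?E)"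
      using AE_regular AE_space
    proof eventually_elim
      case (elim \<omega>)
      have "(\<omega> \<in> ?E) = (\<forall>j\<le>n. \<forall>i\<in>F. \<omega> j $ i < u j $ i)"
        using elim(2) by (auto simp: prod_emb_def PiE_iff space_PiM)
      then show ?case
        using X_lim_le_scale[OF elim(1)] elim(2) by auto
    qed
    show "?E \<in> sets \<Omega>"
      using A by (intro sets_PiM_I) auto
  qed measurable
  also have "\<dots> = (\<Prod>j\<le>n. emeasure (V j) (?A j))"
    using A by (intro emeasure_PiM_emb prob_space_V) auto
  also have "\<dots> = ennreal (\<Prod>j\<le>n. \<Sum>\<nu> | F \<subseteq> zero_set \<nu>. z j \<nu>)"
    unfolding emeasure_vertex_measure_lower[OF u z]
    by (rule prod_ennreal) (use z in \<open>auto simp: vertex_weights_def intro!: sum_nonneg\<close>)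
  finally show ?thesis .
qed

end

end

section \<open>Vertex copulas from Moebius inversion\<close>

lemma sum_zero_set:
  "(\<Sum>\<nu> | P (zero_set \<nu>). f (zero_set \<nu>)) = (\<Sum>S | P S. f S)"
  by (rule sum.reindex_bij_witness[of _ "\<lambda>S. \<chi> i. i \<notin> S" zero_set]) (auto simp: zero_set_def vec_eq_iff)

lemma vertex_volume_eq_moebius: "vertex_volume u \<nu> = moebius (\<lambda>G. \<Prod>i\<in>G. u $ i) (zero_set \<nu>)"
  unfolding moebius_prod by (auto simp: vertex_volume_def zero_set_def intro!: prod.cong)

text \<open>The projection to a face forgets the factors of the box in the other
  coordinates.\<close>

lemma distr_vertex_box_cong:
  fixes u :: "real^'n::finite"
  assumes u: "interior_point u" and eq: "zero_set \<nu> \<inter> {i. \<kappa> $ i} = zero_set \<nu>' \<inter> {i. \<kappa> $ i}"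
  shows "distr (uniform_measure lborel (vertex_box u \<nu>)) borel (proj_along (compl_face (front_face \<kappa>))) =
    distr (uniform_measure lborel (vertex_box u \<nu>')) borel (proj_along (compl_face (front_face \<kappa>)))"
proof -
  let ?\<pi> = "proj_along (compl_face (front_face \<kappa>))"
  have "\<nu> $ i = \<nu>' $ i" if "\<kappa> $ i" for i
    using eq that by (auto simp: zero_set_def)
  then have "?\<pi> \<circ> affine_box (vertex_lower u \<nu>) (vertex_upper u \<nu>) =
      ?\<pi> \<circ> affine_box (vertex_lower u \<nu>') (vertex_upper u \<nu>')"
    by (auto simp: fun_eq_iff proj_along_compl_front_face affine_box_def vertex_lower_def vertex_upper_def vec_eq_iff)
  then show ?thesis
    unfolding vertex_box_eq uniform_box_eq_distr[OF vertex_lower_less_upper[OF u]]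
    by (subst (1 2) distr_distr) (auto cong: measurable_cong_sets)
qed

text \<open>By \<open>sum_moebius_trace\<close>, the marginal of the measure on a front face depends only
  on the values of \<open>g\<close> on the subsets of the coordinates of that face.\<close>

lemma face_marginal_moebius:
  fixes u :: "real^'n::finite" and \<kappa> :: "'n vertex"
  assumes u: "interior_point u" and nonneg: "\<And>S. 0 \<le> moebius g S"
  defines "T \<equiv> {i. \<kappa> $ i}"
  shows "face_marginal (vertex_measure u (\<lambda>\<nu>. moebius g (zero_set \<nu>))) (front_face \<kappa>) =
    mixture (Pow T) (\<lambda>S. ennreal (\<Sum>G | S \<subseteq> G \<and> G \<subseteq> T. (-1) ^ card (G - S) * g G))
      (\<lambda>S. distr (uniform_measure lborel (vertex_box u (\<chi> i. i \<notin> S))) borel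
         (proj_along (compl_face (front_face \<kappa>))))"
proof -
  let ?\<pi> = "proj_along (compl_face (front_face \<kappa>))"
  let ?z = "\<lambda>\<nu>. ennreal (moebius g (zero_set \<nu>))"
  let ?D = "\<lambda>S. distr (uniform_measure lborel (vertex_box u (\<chi> i. i \<notin> S))) borel ?\<pi>"
  have "face_marginal (vertex_measure u (\<lambda>\<nu>. moebius g (zero_set \<nu>))) (front_face \<kappa>) =
      mixture UNIV ?z (\<lambda>\<nu>. distr (uniform_measure lborel (vertex_box u \<nu>)) borel ?\<pi>)"
    unfolding face_marginal_def vertex_measure_def by (rule distr_mixture) auto
  \<comment> \<open>Trimming the zero set to \<open>T\<close> does not change the projected box, so
    vertices can be grouped by their trace on \<open>T\<close>.\<close>
  also have "\<dots> = mixture UNIV ?z (\<lambda>\<nu>. ?D (zero_set \<nu> \<inter> T))"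
    by (intro mixture_cong refl distr_vertex_box_cong u) (auto simp: zero_set_def T_def)
  also have "\<dots> = mixture (Pow T) (\<lambda>S. \<Sum>\<nu> | \<nu> \<in> UNIV \<and> zero_set \<nu> \<inter> T = S. ?z \<nu>) ?D"
    by (rule mixture_group) auto
  also have "\<dots> = mixture (Pow T) (\<lambda>S. ennreal (\<Sum>G | S \<subseteq> G \<and> G \<subseteq> T. (-1) ^ card (G - S) * g G)) ?D"
  proof (rule mixture_cong)
    fix S assume "S \<in> Pow T"
    then have "(\<Sum>\<nu> | zero_set \<nu> \<inter> T = S. moebius g (zero_set \<nu>)) =
        (\<Sum>G | S \<subseteq> G \<and> G \<subseteq> T. (-1) ^ card (G - S) * g G)"
      unfolding sum_zero_set[of "moebius g" "\<lambda>R. R \<inter> T = S"] by (intro sum_moebius_trace) auto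
    then show "(\<Sum>\<nu> | \<nu> \<in> UNIV \<and> zero_set \<nu> \<inter> T = S. ?z \<nu>) =
        ennreal (\<Sum>G | S \<subseteq> G \<and> G \<subseteq> T. (-1) ^ card (G - S) * g G)"
      using nonneg by (simp add: sum_ennreal)
  qed auto
  finally show ?thesis .
qed

lemma vertex_weights_moebius:
  assumes "\<And>S. 0 \<le> moebius g S" "g {} = 1"
  shows "vertex_weights (\<lambda>\<nu>. moebius g (zero_set \<nu>))"
  using assms sum_zero_set[of "moebius g" "\<lambda>_. True"] sum_moebius_supersets[of g "{}"]
  by (simp add: vertex_weights_def)

text \<open>With product values on all sets \<open>g\<close> would give the uniform measure. A
  marginal on a face of dimension \<open>k\<close> involves \<open>g\<close> only on sets of at most
  \<open>k\<close> coordinates, where \<open>g\<close> has these values.\<close>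

lemma moebius_in_vertex_copulas:
  fixes u :: "real^'n::finite"
  assumes u: "interior_point u" and nonneg: "\<And>S. 0 \<le> moebius g S"
    and g: "\<And>S. card S \<le> k \<Longrightarrow> g S = (\<Prod>i\<in>S. u $ i)"
  shows "(\<lambda>\<nu>. moebius g (zero_set \<nu>)) \<in> vertex_copulas k u"
proof -
  let ?z = "\<lambda>\<nu>. moebius g (zero_set \<nu>)"
  have w: "vertex_weights ?z"
    using nonneg g[of "{}"] by (intro vertex_weights_moebius) auto
  interpret prob_space "vertex_measure u ?z"
    using u w by (rule prob_space_vertex_measure)
  have "?z \<nu> \<le> (\<Sum>\<nu>\<in>UNIV. ?z \<nu>)" for \<nu>
    using nonneg by (intro member_le_sum) auto
  then have "?z \<nu> \<le> 1" for \<nu>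
    using w by (simp add: vertex_weights_def)
  moreover have "emeasure (vertex_measure u ?z) (cbox 0 1) = 1"
    using AE_vertex_measure[OF u, of ?z] by (intro emeasure_eq_1_AE) (auto elim: eventually_mono)
  moreover have "face_marginal (vertex_measure u ?z) (front_face \<kappa>) = uniform_face (front_face \<kappa>)"
    if "dim (front_face \<kappa>) = k" for \<kappa> :: "'n vertex"
  proof -
    let ?T = "{i. \<kappa> $ i}"
    have "(\<Sum>G | S \<subseteq> G \<and> G \<subseteq> ?T. (-1) ^ card (G - S) * g G) =
        (\<Sum>G | S \<subseteq> G \<and> G \<subseteq> ?T. (-1) ^ card (G - S) * (\<Prod>i\<in>G. u $ i))" for S
    proof (rule sum.cong[OF refl])
      fix G assume "G \<in> {G. S \<subseteq> G \<and> G \<subseteq> ?T}"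
      then have "card G \<le> k"
        using that by (auto simp: dim_front_face intro: card_mono)
      then show "(-1) ^ card (G - S) * g G = (-1) ^ card (G - S) * (\<Prod>i\<in>G. u $ i)"
        by (simp add: g)
    qed
    moreover have "0 \<le> moebius (\<lambda>G. \<Prod>i\<in>G. u $ i) S" for S
      unfolding moebius_prod using u by (intro prod_nonneg) (auto simp: interior_point_def less_imp_le)
    moreover have "uniform_cube = vertex_measure u (\<lambda>\<nu>. moebius (\<lambda>G. \<Prod>i\<in>G. u $ i) (zero_set \<nu>))"
      unfolding uniform_cube_eq_vertex_measure[OF u] vertex_volume_eq_moebius ..
    ultimately show ?thesis
      unfolding uniform_face_def by (simp only: face_marginal_moebius[OF u] nonneg)
  qed
  ultimately show ?thesis
    using nonneg prob_space_axioms
    by (auto simp: vertex_copulas_def copula_def front_faces_def)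
qed

section \<open>Scales with bounded ratios\<close>

text \<open>Greedy choice: from the scale \<open>x\<close> move to some term of \<open>t\<close> in
  the window from \<open>p\<^sup>2 * x\<close> to \<open>p * x\<close> if there is one, otherwise to
  \<open>p * x\<close>. If the hits ended, the scales would become geometric with ratio
  \<open>p\<close>; their consecutive windows share endpoints and cover all small positive numbers,
  hence some \<open>t j\<close>.\<close>

lemma ex_scales:
  fixes t :: "nat \<Rightarrow> real"
  assumes p: "0 < p" "p < 1" and t_pos: "\<And>n. 0 < t n" and t: "t \<longlonglongrightarrow> 0"
  obtains \<sigma> where "\<sigma> 0 = p" "\<And>n. 0 < \<sigma> n" "\<And>n. p\<^sup>2 * \<sigma> n \<le> \<sigma> (Suc n)" "\<And>n. \<sigma> (Suc n) \<le> p * \<sigma> n"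
    "\<sigma> \<longlonglongrightarrow> 0" "infinite {j. t j \<in> range \<sigma>}"
proof -
  define hit where "hit x j \<longleftrightarrow> p\<^sup>2 * x \<le> t j \<and> t j \<le> p * x" for x j
  define nxt where "nxt x = (if \<exists>j. hit x j then t (SOME j. hit x j) else p * x)" for x
  define \<sigma> where "\<sigma> n = (nxt ^^ n) p" for n
  have \<sigma>_Suc: "\<sigma> (Suc n) = nxt (\<sigma> n)" for n
    by (simp add: \<sigma>_def)
  have hit_nxt: "hit x (SOME j. hit x j)" if "\<exists>j. hit x j" for x
    using that by (rule someI_ex)
  have pos: "0 < \<sigma> n" for n
  proof (induction n)
    case (Suc n)
    then show ?case using p t_pos by (simp add: \<sigma>_Suc nxt_def)
  qed (use p in \<open>simp add: \<sigma>_def\<close>)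
  have lower: "p\<^sup>2 * \<sigma> n \<le> \<sigma> (Suc n)" and upper: "\<sigma> (Suc n) \<le> p * \<sigma> n" for n
  proof -
    have "p\<^sup>2 * \<sigma> n \<le> p * \<sigma> n"
      using p pos[of n] by (simp add: power2_eq_square)
    then show "p\<^sup>2 * \<sigma> n \<le> \<sigma> (Suc n)" "\<sigma> (Suc n) \<le> p * \<sigma> n"
      using hit_nxt[of "\<sigma> n"] by (auto simp: \<sigma>_Suc nxt_def hit_def)
  qed
  have "\<sigma> (Suc n) < \<sigma> n" for n
  proof -
    have "p * \<sigma> n < 1 * \<sigma> n"
      using p pos[of n] by (intro mult_strict_right_mono) auto
    with upper[of n] show ?thesis by simp
  qed
  then have "strict_mono (\<lambda>n. - \<sigma> n)"
    by (simp add: strict_mono_Suc_iff)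
  then have inj: "inj \<sigma>"
    using strict_mono_eq[of "\<lambda>n. - \<sigma> n"] by (auto simp: inj_on_def)
  have bound: "\<sigma> (m + i) \<le> p ^ i * \<sigma> m" for m i
  proof (induction i)
    case (Suc i)
    have "\<sigma> (Suc (m + i)) \<le> p * (p ^ i * \<sigma> m)"
      using upper[of "m + i"] Suc p by (meson less_imp_le mult_left_mono order_trans)
    then show ?case by (simp add: mult.assoc)
  qed simp
  have tends: "(\<lambda>i. p ^ i * x) \<longlonglongrightarrow> 0" for x
    using p by (intro tendsto_mult_left_zero LIMSEQ_power_zero) simp
  have "\<sigma> \<longlonglongrightarrow> 0"
    by (rule tendsto_sandwich[OF _ _ tendsto_const tends[of "\<sigma> 0"]])
      (use bound[of 0] pos in \<open>auto simp: less_imp_le\<close>)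
  have "\<exists>m\<ge>M. \<sigma> m \<in> range t" for M
  proof (rule ccontr)
    assume none: "\<not> (\<exists>m\<ge>M. \<sigma> m \<in> range t)"
    have no_hit: "\<not> hit (\<sigma> m) j" if "M \<le> m" for m j
    proof
      assume "hit (\<sigma> m) j"
      then have "\<sigma> (Suc m) \<in> range t"
        by (auto simp: \<sigma>_Suc nxt_def)
      with none that show False by (metis le_SucI)
    qed
    have geom: "\<sigma> (M + i) = p ^ i * \<sigma> M" for i
    proof (induction i)
      case (Suc i)
      have "\<sigma> (Suc (M + i)) = p * \<sigma> (M + i)"
        using no_hit[of "M + i"] by (simp add: \<sigma>_Suc nxt_def)
      with Suc show ?case by simp
    qed simp
    \<comment> \<open>Choose a term of \<open>t\<close> below the top of the window at
      \<open>M\<close>, so that it lies in this window or a later one.\<close>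
    have "0 < p * \<sigma> M"
      using p pos by simp
    from order_tendstoD(2)[OF t this] obtain j where j: "t j < p * \<sigma> M"
      by (auto simp: eventually_sequentially)
    have ex: "\<exists>i. p ^ i * (p\<^sup>2 * \<sigma> M) < t j"
      using order_tendstoD(2)[OF tends[of "p\<^sup>2 * \<sigma> M"] t_pos[of j]] by (auto simp: eventually_sequentially)
    \<comment> \<open>The first window whose bottom is below \<open>t j\<close>. By minimality
      \<open>t j\<close> is not below the bottom of the preceding window, which is the top of this
      one.\<close>
    define i where "i = (LEAST i. p ^ i * (p\<^sup>2 * \<sigma> M) < t j)"
    have i: "p ^ i * (p\<^sup>2 * \<sigma> M) < t j"
      unfolding i_def using ex by (rule LeastI_ex)
    have "t j \<le> p * \<sigma> (M + i)"
    proof (cases i)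
      case (Suc i')
      then have "\<not> p ^ i' * (p\<^sup>2 * \<sigma> M) < t j"
        using not_less_Least[of i' "\<lambda>i. p ^ i * (p\<^sup>2 * \<sigma> M) < t j"] by (simp flip: i_def)
      then show ?thesis
        unfolding geom Suc by (simp add: power2_eq_square mult_ac)
    qed (use j in simp)
    moreover have "p\<^sup>2 * \<sigma> (M + i) \<le> t j"
      using i unfolding geom by (simp add: mult_ac)
    ultimately have "hit (\<sigma> (M + i)) j"
      by (simp add: hit_def)
    with no_hit show False by auto
  qed
  \<comment> \<open>Infinitely many scales are terms of \<open>t\<close>. They are distinct values
    by injectivity, so infinitely many indices of \<open>t\<close> are hit as well.\<close>
  then have "infinite {m. \<sigma> m \<in> range t}"
    unfolding infinite_nat_iff_unbounded_le by auto
  then have "infinite (\<sigma> ` {m. \<sigma> m \<in> range t})"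
    using inj finite_imageD inj_on_subset by blast
  moreover have "\<sigma> ` {m. \<sigma> m \<in> range t} \<subseteq> t ` {j. t j \<in> range \<sigma>}"
  proof
    fix x assume "x \<in> \<sigma> ` {m. \<sigma> m \<in> range t}"
    then obtain m j where "x = \<sigma> m" "\<sigma> m = t j" by blast
    then show "x \<in> t ` {j. t j \<in> range \<sigma>}"
      by (intro image_eqI[of _ _ j]) (auto intro: range_eqI[of _ _ m])
  qed
  ultimately have "infinite {j. t j \<in> range \<sigma>}"
    using finite_surj by blast
  then show thesis
    using that[of \<sigma>] pos lower upper \<open>\<sigma> \<longlonglongrightarrow> 0\<close> by (simp add: \<sigma>_def)
qed

section \<open>Tail degrees from geometric scales\<close>

lemma Inf_ereal_greaterThan: "Inf {ereal \<tau> | \<tau>. b < \<tau>} = ereal b"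
proof (rule antisym)
  show "Inf {ereal \<tau> | \<tau>. b < \<tau>} \<le> ereal b"
  proof (rule dense_ge)
    fix y assume "ereal b < y"
    then obtain c where "ereal b < ereal c" "ereal c < y"
      using ereal_dense2 by blast
    then show "Inf {ereal \<tau> | \<tau>. b < \<tau>} \<le> y"
      by (intro Inf_lower2[of "ereal c"]) auto
  qed
qed (auto intro!: Inf_greatest)

text \<open>Between consecutive scales monotonicity costs at most the factor
  \<open>r powr b\<close>, so \<open>f s\<close> dominates a multiple of \<open>s powr b\<close> for
  all small \<open>s\<close>, and the quotient diverges for \<open>\<tau> > b\<close>. For
  \<open>\<tau> \<le> b\<close> the quotient along the scales stays at most \<open>a\<close>, as the
  scales are at most 1.\<close>

lemma tail_degree_eq:
  fixes f :: "real \<Rightarrow> real"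
  assumes \<sigma>: "\<And>n. 0 < \<sigma> n" "\<sigma> 0 \<le> 1" "\<And>n. r * \<sigma> n \<le> \<sigma> (Suc n)" "decseq \<sigma>" "\<sigma> \<longlonglongrightarrow> 0"
    and r: "0 < r" and a: "0 < a" and b: "0 \<le> b"
    and mono: "\<And>s s'. 0 < s \<Longrightarrow> s \<le> s' \<Longrightarrow> f s \<le> f s'"
    and f: "\<And>n. f (\<sigma> n) = a * \<sigma> n powr b"
  shows "Inf {ereal \<tau> | \<tau> :: real. Liminf (at_right 0) (\<lambda>s. ereal (f s / s powr \<tau>)) = \<infinity>} = ereal b"
proof -
  have "Liminf (at_right 0) (\<lambda>s. ereal (f s / s powr \<tau>)) = \<infinity> \<longleftrightarrow> b < \<tau>" for \<tau>
  proof
    assume \<tau>: "b < \<tau>"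
    define C where "C = a * r powr b"
    have C: "C > 0" using a r by (simp add: C_def)
    have lower: "C * s powr b \<le> f s" if s: "0 < s" "s < \<sigma> 0" for s
    proof -
      have "\<exists>n. \<sigma> n < s"
        using order_tendstoD(2)[OF \<sigma>(5) s(1)] by (auto simp: eventually_sequentially)
      \<comment> \<open>The first scale below \<open>s\<close>. It has index at least 1 because
        \<open>s < \<sigma> 0\<close>, so its predecessor is at least \<open>s\<close> and the ratio
        bound gives \<open>r * s \<le> \<sigma> n\<close>.\<close>
      define n where "n = (LEAST n. \<sigma> n < s)"
      have n: "\<sigma> n < s"
        unfolding n_def using \<open>\<exists>n. \<sigma> n < s\<close> by (rule LeastI_ex)
      then obtain m where m: "n = Suc m"
        using s by (cases n) auto
      have "\<not> \<sigma> m < s"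
        using not_less_Least[of m "\<lambda>n. \<sigma> n < s"] by (simp add: m flip: n_def)
      then have "r * s \<le> \<sigma> n"
        using \<sigma>(3)[of m] r mult_left_mono[of s "\<sigma> m" r] unfolding m by linarith
      then have "(r * s) powr b \<le> \<sigma> n powr b"
        using r s b by (intro powr_mono2) auto
      then have "C * s powr b \<le> a * \<sigma> n powr b"
        using r s a by (simp add: C_def powr_mult)
      also have "\<dots> \<le> f s"
        using f[of n] mono[of "\<sigma> n" s] n \<sigma>(1)[of n] by simp
      finally show ?thesis .
    qed
    have "filterlim (\<lambda>s. C * s powr (b - \<tau>)) at_top (at_right 0)"
      using \<tau> C by real_asymp
    moreover have "\<forall>\<^sub>F s in at_right 0. s \<in> {0<..<\<sigma> 0}"
      using \<sigma>(1) by (rule eventually_at_right_real)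
    then have "\<forall>\<^sub>F s in at_right 0. C * s powr (b - \<tau>) \<le> f s / s powr \<tau>"
    proof eventually_elim
      case (elim s)
      then show ?case
        using lower[of s] by (simp add: powr_diff field_simps)
    qed
    ultimately have "filterlim (\<lambda>s. f s / s powr \<tau>) at_top (at_right 0)"
      by (rule filterlim_at_top_mono)
    then have "((\<lambda>s. ereal (f s / s powr \<tau>)) \<longlongrightarrow> \<infinity>) (at_right 0)"
      by (simp add: tendsto_PInfty_eq_at_top)
    then show "Liminf (at_right 0) (\<lambda>s. ereal (f s / s powr \<tau>)) = \<infinity>"
      by (intro lim_imp_Liminf) auto
  next
    assume inf: "Liminf (at_right 0) (\<lambda>s. ereal (f s / s powr \<tau>)) = \<infinity>"
    show "b < \<tau>"
    proof (rule ccontr)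
      assume "\<not> b < \<tau>"
      have "\<forall>\<^sub>F s in at_right 0. ereal a < ereal (f s / s powr \<tau>)"
        by (rule less_LiminfD) (simp add: inf)
      moreover have "\<sigma> n \<noteq> 0" for n
        using \<sigma>(1)[of n] by simp
      then have "filterlim \<sigma> (at_right 0) sequentially"
        using \<sigma>(1,5) by (auto simp: filterlim_at)
      ultimately have "\<forall>\<^sub>F n in sequentially. ereal a < ereal (f (\<sigma> n) / \<sigma> n powr \<tau>)"
        by (rule eventually_compose_filterlim)
      then obtain n where n: "a < f (\<sigma> n) / \<sigma> n powr \<tau>"
        by (auto simp: eventually_sequentially)
      have "f (\<sigma> n) / \<sigma> n powr \<tau> = a * \<sigma> n powr (b - \<tau>)"
        by (simp add: f powr_diff)
      also have "\<sigma> n powr (b - \<tau>) \<le> 1"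
        using \<open>\<not> b < \<tau>\<close> \<sigma>(1)[of n] decseqD[OF \<sigma>(4), of 0 n] \<sigma>(2) by (intro powr_le1) auto
      then have "a * \<sigma> n powr (b - \<tau>) \<le> a"
        using a by simp
      finally show False using n by simp
    qed
  qed
  then show ?thesis
    by (simp add: Inf_ereal_greaterThan)
qed

section \<open>Front faces\<close>

abbreviation set_face :: "'n::finite set \<Rightarrow> (real^'n) set" where
  "set_face S \<equiv> front_face (\<chi> i. i \<in> S)"

lemma front_faces_eq: "(front_faces :: (real^'n::finite) set set) = range set_face"
proof
  have "front_face \<nu> = set_face {i. \<nu> $ i}" for \<nu> :: "'n vertex"
    by (simp add: vec_lambda_eta)
  then show "(front_faces :: (real^'n) set set) \<subseteq> range set_face"
    unfolding front_faces_def by (intro image_subsetI) (metis rangeI)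
qed (auto simp: front_faces_def)

lemma dim_set_face: "dim (set_face S) = card S"
  by (simp add: dim_front_face)

lemma set_face_subset_iff: "set_face S \<subseteq> set_face S' \<longleftrightarrow> S \<subseteq> S'"
proof
  assume sub: "set_face S \<subseteq> set_face S'"
  show "S \<subseteq> S'"
  proof
    fix i assume "i \<in> S"
    then have "(\<chi> j. if j \<in> S then 1 else 0) \<in> set_face S"
      by (simp add: front_face_def mem_box_cart)
    then have "(\<chi> j. if j \<in> S then 1 else (0::real)) \<in> set_face S'"
      using sub by blast
    with \<open>i \<in> S\<close> show "i \<in> S'"
      by (auto simp: front_face_def)
  qed
qed (auto simp: front_face_def)

lemma set_face_eq_iff: "set_face S = set_face S' \<longleftrightarrow> S = S'"
  by (simp add: set_eq_subset[of "set_face S"] set_eq_subset[of S] set_face_subset_iff)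

lemma set_face_psubset_iff: "set_face S \<subset> set_face S' \<longleftrightarrow> S \<subset> S'"
  by (simp add: psubset_eq set_face_subset_iff set_face_eq_iff)

text \<open>The preimage of the shrunken face under the projection is a cylinder constrained only in
  the coordinates of \<open>S\<close>.\<close>

lemma tail_mass_set_face:
  fixes c :: "(real^'n::finite) measure"
  assumes "sets c = sets borel" "0 < s"
  shows "tail_mass c (set_face S) s = measure c {x. \<forall>i\<in>S. 0 \<le> x $ i \<and> x $ i \<le> s}"
proof -
  have [simp]: "space c = UNIV"
    using sets_eq_imp_space_eq[OF assms(1)] by simp
  have eq: "(\<lambda>x. s *\<^sub>R x) ` set_face S = {x. \<forall>i. if i \<in> S then 0 \<le> x $ i \<and> x $ i \<le> s else x $ i = 0}"
  proof safe
    fix x :: "real^'n" assume x: "\<forall>i. if i \<in> S then 0 \<le> x $ i \<and> x $ i \<le> s else x $ i = 0"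
    have "0 \<le> x $ i \<and> x $ i \<le> s" for i
      using x[rule_format, of i] assms(2) by (cases "i \<in> S") auto
    then have "(1 / s) *\<^sub>R x \<in> set_face S"
      using x assms(2) by (auto simp: front_face_def mem_box_cart)
    moreover have "x = s *\<^sub>R ((1 / s) *\<^sub>R x)"
      using assms(2) by simp
    ultimately show "x \<in> (\<lambda>x. s *\<^sub>R x) ` set_face S"
      by blast
  next
    fix x :: "real^'n" and i assume "x \<in> set_face S"
    then show "if i \<in> S then 0 \<le> (s *\<^sub>R x) $ i \<and> (s *\<^sub>R x) $ i \<le> s else (s *\<^sub>R x) $ i = 0"
      using assms(2) by (auto simp: front_face_def mem_box_cart mult_left_le)
  qed
  have "{x :: real^'n. \<forall>i. if i \<in> S then 0 \<le> x $ i \<and> x $ i \<le> s else x $ i = 0} \<in> sets borel"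
    by measurable
  then have "tail_mass c (set_face S) s =
    measure c (proj_along (compl_face (set_face S)) -` {x. \<forall>i. if i \<in> S then 0 \<le> x $ i \<and> x $ i \<le> s else x $ i = 0})"
    unfolding tail_mass_def face_marginal_def eq using assms(1)
    by (subst measure_distr) (auto cong: measurable_cong_sets)
  also have "proj_along (compl_face (set_face S)) -` {x. \<forall>i. if i \<in> S then 0 \<le> x $ i \<and> x $ i \<le> s else x $ i = 0} =
      {x. \<forall>i\<in>S. 0 \<le> x $ i \<and> x $ i \<le> s}"
    by (auto simp: proj_along_compl_front_face)
  finally show ?thesis .
qed

text \<open>Each of the finitely many inequalities holds for all sufficiently small
  \<open>q\<close>, so one \<open>p\<close> serves all of them. The first family is for the initial
  nesting step, the second for the later ones.\<close>

lemma ex_scale_bound: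
  fixes a b :: "(real^'n::finite) set \<Rightarrow> real"
  assumes a: "\<forall>F\<in>front_faces. 0 < a F" and NC: "NC k a b"
    and inc: "\<forall>F\<in>front_faces. increasing_at b F \<or> eventually_constant_at b F"
  obtains p where "0 < p" "p < 1"
    "\<And>q S. 0 < q \<Longrightarrow> q \<le> p \<Longrightarrow> 0 \<le> moebius (\<lambda>S. a (set_face S) * q powr b (set_face S)) S"
    "\<And>q S. 0 < q \<Longrightarrow> q \<le> p \<Longrightarrow> 0 \<le> moebius (\<lambda>S. q powr b (set_face S)) S"
proof -
  let ?A = "\<lambda>S :: 'n set. a (set_face S)" and ?B = "\<lambda>S :: 'n set. b (set_face S)"
  \<comment> \<open>At an eventually constant face the alternating sum in \<open>NC\<close> is the
    Moebius inverse of \<open>a\<close>, rewritten from faces to coordinate sets.\<close>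
  have cases: "(\<forall>G. S \<subset> G \<longrightarrow> ?B S < ?B G) \<or> (\<forall>G. S \<subset> G \<longrightarrow> ?B S = ?B G) \<and> moebius ?A S \<ge> 0" for S
  proof (cases "increasing_at b (set_face S)")
    case True
    then show ?thesis
      by (auto simp: increasing_at_def front_faces_eq set_face_psubset_iff)
  next
    case False
    then have ec: "eventually_constant_at b (set_face S)"
      using inc by (auto simp: front_faces_eq)
    then have "0 \<le> (\<Sum>F' | F' \<in> front_faces \<and> set_face S \<subseteq> F'. (-1) ^ (dim F' - dim (set_face S)) * a F')"
      using NC by (simp add: NC_def front_faces_eq)
    also have "\<dots> = (\<Sum>F'\<in>set_face ` {G. S \<subseteq> G}. (-1) ^ (dim F' - dim (set_face S)) * a F')"
    proof (rule sum.cong)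
      have iff: "F' \<in> front_faces \<and> set_face S \<subseteq> F' \<longleftrightarrow> (\<exists>G. F' = set_face G \<and> set_face S \<subseteq> set_face G)" for F'
        unfolding front_faces_eq by blast
      show "{F' \<in> front_faces. set_face S \<subseteq> F'} = set_face ` {G. S \<subseteq> G}"
        by (intro set_eqI)
          (simp only: mem_Collect_eq image_iff Bex_def iff set_face_subset_iff conj_commute)
    qed auto
    also have "\<dots> = (\<Sum>G | S \<subseteq> G. (-1) ^ (card G - card S) * ?A G)"
      by (subst sum.reindex) (auto simp: inj_on_def set_face_eq_iff dim_set_face)
    also have "\<dots> = moebius ?A S"
      unfolding moebius_def by (intro sum.cong refl) (simp add: card_Diff_subset)
    finally show ?thesis
      using ec by (auto simp: eventually_constant_at_def front_faces_eq set_face_psubset_iff)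
  qed
  have "\<forall>\<^sub>F q in at_right 0. 0 \<le> moebius (\<lambda>S. ?A S * q powr ?B S) S" for S
    using cases[of S] a by (intro eventually_moebius_powr_nonneg) (auto simp: front_faces_eq)
  moreover have "\<forall>\<^sub>F q in at_right 0. 0 \<le> moebius (\<lambda>S. 1 * q powr ?B S) S" for S
    using cases[of S] by (intro eventually_moebius_powr_nonneg) (auto simp: moebius_one_nonneg)
  moreover have "\<forall>\<^sub>F q::real in at_right 0. q < 1"
    using eventually_at_right_real[of 0 "1::real"] by (auto elim: eventually_mono)
  ultimately have "\<forall>\<^sub>F q in at_right 0. q < 1 \<and> (\<forall>S. 0 \<le> moebius (\<lambda>S. ?A S * q powr ?B S) S) \<and>
      (\<forall>S. 0 \<le> moebius (\<lambda>S. q powr ?B S) S)"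
    by (auto intro!: eventually_conj eventually_all_finite)
  then obtain d where d: "d > 0" "\<And>q. 0 < q \<Longrightarrow> q < d \<Longrightarrow> q < 1 \<and> (\<forall>S. 0 \<le> moebius (\<lambda>S. ?A S * q powr ?B S) S) \<and>
      (\<forall>S. 0 \<le> moebius (\<lambda>S. q powr ?B S) S)"
    unfolding eventually_at_right_field by blast
  \<comment> \<open>The bound \<open>d\<close> is strict while \<open>q = p\<close> must be allowed,
    hence half of it.\<close>
  show thesis
  proof (rule that[of "d / 2"])
    show "d / 2 < 1"
      using d(1) d(2)[of "d / 2"] by simp
  qed (use d in auto)
qed

theorem corollary7p6:
  fixes k :: nat
    and a b :: "(real^'n::finite) set \<Rightarrow> real"
    and t :: "nat \<Rightarrow> real"
  assumes "1 \<le> k" and "k \<le> CARD('n)"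
    and "\<forall>F\<in>front_faces. 0 < a F"
    and "\<forall>F\<in>front_faces. 0 \<le> b F"
    and "NC k a b"
    and "\<forall>F\<in>front_faces. increasing_at b F \<or> eventually_constant_at b F"
    and "\<forall>n. 0 < t n \<and> t n \<le> 1"
    and "t \<longlonglongrightarrow> 0"
  shows "\<exists>(\<phi> :: nat \<Rightarrow> nat) (u :: nat \<Rightarrow> real^'n) (z :: nat \<Rightarrow> 'n vertex \<Rightarrow> real) (c :: (real^'n) measure).
    strict_mono \<phi> \<and>
    (\<forall>n. (\<forall>i. 0 < u n $ i \<and> u n $ i < 1) \<and> z n \<in> vertex_copulas k (u n)) \<and>
    is_tnest_limit u z c \<and>
    (\<forall>F\<in>front_faces. (\<lambda>n. tail_mass c F (t (\<phi> n)) / t (\<phi> n) powr b F) \<longlonglongrightarrow> a F) \<and>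
    (\<forall>F\<in>front_faces. tdeg c F = ereal (b F))"
proof -
  obtain p where p: "0 < p" "p < 1"
    and nonneg_0: "\<And>q S. 0 < q \<Longrightarrow> q \<le> p \<Longrightarrow> 0 \<le> moebius (\<lambda>S. a (set_face S) * q powr b (set_face S)) S"
    and nonneg_1: "\<And>q S. 0 < q \<Longrightarrow> q \<le> p \<Longrightarrow> 0 \<le> moebius (\<lambda>S. q powr b (set_face S)) S"
    using ex_scale_bound[OF assms(3,5,6)] by blast
  obtain \<sigma> where \<sigma>: "\<sigma> 0 = p" "\<And>n. 0 < \<sigma> n" "\<And>n. p\<^sup>2 * \<sigma> n \<le> \<sigma> (Suc n)" "\<And>n. \<sigma> (Suc n) \<le> p * \<sigma> n"
    "\<sigma> \<longlonglongrightarrow> 0" and inf: "infinite {j. t j \<in> range \<sigma>}"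
    using ex_scales[OF p, of t] assms(7,8) by blast
  \<comment> \<open>Ratios of consecutive scales, started with \<open>\<sigma> 0\<close> itself so
    that their products telescope to the scales.\<close>
  define q where "q n = (case n of 0 \<Rightarrow> \<sigma> 0 | Suc m \<Rightarrow> \<sigma> (Suc m) / \<sigma> m)" for n
  have q: "0 < q n" "q n \<le> p" for n
    using \<sigma>(1,2,4) p by (auto simp: q_def field_simps split: nat.split)
  \<comment> \<open>The factor \<open>a\<close> enters only at index 0, so that it occurs exactly
    once in every product of tail masses.\<close>
  define g where "g n S = (if n = 0 then a (set_face S) else 1) * q n powr b (set_face S)" for n and S :: "'n set"
  define u where "u n = (\<chi> i::'n. q n)" for n :: nat
  have u_nth: "u n $ i = q n" for n i
    by (simp add: u_def)
  define z where "z n \<nu> = moebius (g n) (zero_set \<nu>)" for n and \<nu> :: "'n vertex"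
  \<comment> \<open>The subsequence lists the indices at which \<open>t\<close> is one of the
    scales; there the tail mass is known exactly and the quotient equals \<open>a\<close> rather
    than merely approaching it.\<close>
  define \<phi> where "\<phi> = enumerate {j. t j \<in> range \<sigma>}"
  have u: "interior_point (u n)" for n
    using q[of n] p by (simp add: interior_point_def u_def)
  have g_nonneg: "0 \<le> moebius (g n) S" for n S
    using nonneg_0[OF q] nonneg_1[OF q] by (cases "n = 0") (simp_all add: g_def[abs_def])
  \<comment> \<open>Part (ii) of \<open>NC\<close> gives \<open>a = 1\<close> and \<open>b\<close>
    equal to the dimension, so \<open>g\<close> is a power of \<open>q n\<close>, as for the uniform
    measure.\<close>
  have g_small: "g n S = (\<Prod>i\<in>S. u n $ i)" if "card S \<le> k" for n S
    using that assms(5) q[of n]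
    by (simp add: NC_def front_faces_eq dim_set_face g_def u_def powr_realpow)
  have vc: "z n \<in> vertex_copulas k (u n)" for n
    unfolding z_def[abs_def] by (intro moebius_in_vertex_copulas u g_nonneg g_small)
  have "vertex_weights (z n)" for n
    unfolding z_def[abs_def] using g_small[of "{}" n] by (intro vertex_weights_moebius g_nonneg) simp
  then interpret tail_nesting u z
    by unfold_locales (rule u)
  have scale: "scale n $ i = \<sigma> n" for n i
  proof (induction n)
    case (Suc n)
    then show ?case
      using \<sigma>(2)[of n] by (simp add: scale_Suc u_nth) (simp add: q_def)
  qed (simp add: scale_0 u_nth, simp add: q_def)
  have to_0: "(\<lambda>n. scale n $ i) \<longlonglongrightarrow> 0" for i
    using \<sigma>(5) by (simp add: scale)
  define c where "c = limit_law"
  have c: "sets c = sets borel" "prob_space c"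
    using prob_space.prob_space_distr[OF prob_space_\<Omega> measurable_X_lim]
    by (simp_all add: c_def limit_law_def[OF to_0])
  have prod_g: "(\<Prod>j\<le>n. g j S) = a (set_face S) * \<sigma> n powr b (set_face S)" for n S
  proof (induction n)
    case (Suc n)
    have "\<sigma> n powr b (set_face S) > 0"
      using \<sigma>(2)[of n] by simp
    then show ?case
      using Suc \<sigma>(2) by (simp add: g_def q_def powr_divide less_imp_le)
  qed (simp add: g_def q_def)
  have mass: "tail_mass c (set_face S) (\<sigma> n) = a (set_face S) * \<sigma> n powr b (set_face S)" for n S
  proof -
    have sum: "(\<Sum>\<nu> | S \<subseteq> zero_set \<nu>. z j \<nu>) = g j S" for j
      unfolding z_def using sum_zero_set[of "moebius (g j)" "\<lambda>R. S \<subseteq> R"] by (simp add: sum_moebius_supersets)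
    have "emeasure c {x. \<forall>i\<in>S. 0 \<le> x $ i \<and> x $ i \<le> \<sigma> n} = ennreal (a (set_face S) * \<sigma> n powr b (set_face S))"
      using limit_law_tail[OF to_0, of S n] by (simp add: scale c_def sum prod_g)
    moreover have "0 < a (set_face S)"
      using assms(3) by (simp add: front_faces_eq)
    ultimately show ?thesis
      using c(1) \<sigma>(2)[of n] by (simp add: tail_mass_set_face measure_def)
  qed
  have mono: "tail_mass c (set_face S) s \<le> tail_mass c (set_face S) s'" if "0 < s" "s \<le> s'" for S s s'
  proof -
    interpret c: prob_space c by (rule c(2))
    have "{x :: real^'n. \<forall>i\<in>S. 0 \<le> x $ i \<and> x $ i \<le> s'} \<in> sets borel"
      by measurable
    moreover have "{x :: real^'n. \<forall>i\<in>S. 0 \<le> x $ i \<and> x $ i \<le> s} \<subseteq> {x. \<forall>i\<in>S. 0 \<le> x $ i \<and> x $ i \<le> s'}"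
      using that(2) by (intro Collect_mono) (meson order_trans)
    ultimately show ?thesis
      using that c(1) by (simp add: tail_mass_set_face c.finite_measure_mono)
  qed
  have "strict_mono \<phi>"
    unfolding \<phi>_def using inf by (rule strict_mono_enumerate)
  moreover have "\<forall>n. (\<forall>i. 0 < u n $ i \<and> u n $ i < 1) \<and> z n \<in> vertex_copulas k (u n)"
    using u vc by (auto simp: interior_point_def)
  moreover have "is_tnest_limit u z c"
    unfolding c_def by (rule is_tnest_limit_limit_law[OF to_0])
  moreover have "(\<lambda>n. tail_mass c (set_face S) (t (\<phi> n)) / t (\<phi> n) powr b (set_face S)) \<longlonglongrightarrow> a (set_face S)" for S
  proof -
    have "tail_mass c (set_face S) (t (\<phi> n)) / t (\<phi> n) powr b (set_face S) = a (set_face S)" for n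
    proof -
      have "t (\<phi> n) \<in> range \<sigma>"
        using enumerate_in_set[OF inf, of n] by (simp add: \<phi>_def)
      then obtain m where "t (\<phi> n) = \<sigma> m" ..
      then show ?thesis
        using \<sigma>(2)[of m] by (simp add: mass)
    qed
    then show ?thesis by simp
  qed
  moreover have "tdeg c (set_face S) = ereal (b (set_face S))" for S
    unfolding tdeg_def
  proof (rule tail_degree_eq[where \<sigma>=\<sigma> and r="p\<^sup>2" and a="a (set_face S)"])
    have "\<sigma> (Suc n) \<le> \<sigma> n" for n
      using \<sigma>(4)[of n] \<sigma>(2)[of n] p mult_right_mono[of p 1 "\<sigma> n"] by linarith
    then show "decseq \<sigma>"
      by (simp add: decseq_Suc_iff)
  qed (use \<sigma> p assms(3,4) mass mono in \<open>auto simp: front_faces_eq\<close>)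
  ultimately show ?thesis
    by (intro exI[of _ \<phi>] exI[of _ u] exI[of _ z] exI[of _ c]) (auto simp: front_faces_eq)
qed

end
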